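(* Suppose that either $z$ is a positive real number and $\nu\in\mathbb{C}$ is arbitrary, or $z\in\mathbb{C}$ is arbitrary and $\nu$ is a negative integer. Then $$D_{-\nu}(z)^2=\pi e^{-\frac{z^2}{2}}\sum_{n=0}^{+\infty}L_n^{-1}(z^2)\,\frac{2^{-\nu-n}(\nu)_n}{\Gamma\left(\frac{1+n+\nu}{2}\right)^2}$$ and $$D_{-\nu}(z)D_{-\nu}(-z)=\pi e^{-\frac{z^2}{2}}\sum_{n=0}^{+\infty}(-1)^nL_n^{-1}(z^2)\,\frac{2^{-\nu-n}(\nu)_n}{\Gamma\left(\frac{1+n+\nu}{2}\right)^2}.$$
   Context: $(\nu)_n=\nu(\nu+1)\cdots(\nu+n-1)$ is the Pochhammer symbol (with $(\nu)_0=1$), and $1/\Gamma$ is taken to be $0$ at the poles of $\Gamma$. $L_n^{-1}$ is the generalized Laguerre polynomial $L_n^{\alpha}$ with superscript (parameter) $\alpha=-1$, given by the generating function $\sum_{n\ge 0}L_n^{\alpha}(x)s^n=(1-s)^{-\alpha-1}e^{-xs/(1-s)}$ for $|s|<1$. $D_\nu$ is the parabolic cylinder function, the entire function of $z\in\mathbb{C}$ (and of $\nu\in\mathbb{C}$) defined by $$D_\nu(z)=2^{\nu/2}e^{-z^2/4}\left(\frac{\sqrt{\pi}}{\Gamma(\frac12-\frac{\nu}{2})}\Phi\left(-\tfrac{\nu}{2},\tfrac12;\tfrac{z^2}{2}\right)-\frac{\sqrt{2\pi}\,z}{\Gamma(-\frac{\nu}{2})}\Phi\left(\tfrac12-\tfrac{\nu}{2},\tfrac32;\tfrac{z^2}{2}\right)\right),$$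 where $\Phi(\nu,\mu;z)=\sum_{n=0}^{\infty}\frac{(\nu)_n}{(\mu)_n}\frac{z^n}{n!}$ is Kummer's confluent hypergeometric function. *)

theory Defs
  imports "HOL-Complex_Analysis.Complex_Analysis"
begin

definition laguerre_gf :: "complex \<Rightarrow> complex \<Rightarrow> complex \<Rightarrow> complex" where
  "laguerre_gf \<alpha> x s = (1 - s) powr (- \<alpha> - 1) * exp (- (x * s) / (1 - s))"

(* The generalized Laguerre polynomial L_n^alpha(x), as the n-th coefficient of the
   generating function in s at 0. *)
definition laguerre :: "complex \<Rightarrow> nat \<Rightarrow> complex \<Rightarrow> complex" where
  "laguerre \<alpha> n x = fps_nth (fps_expansion (laguerre_gf \<alpha> x) 0) n"

lemma laguerre_gf_holomorphic: "laguerre_gf \<alpha> x holomorphic_on ball 0 1"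
proof -
  have "1 - s \<notin> \<real>\<^sub>\<le>\<^sub>0 \<and> 1 - s \<noteq> 0" if "s \<in> ball 0 1" for s :: complex
  proof -
    have "Re s < 1"
      using that complex_Re_le_cmod[of s] by simp
    then show ?thesis
      by (auto simp: complex_nonpos_Reals_iff)
  qed
  then show ?thesis
    unfolding laguerre_gf_def by (intro holomorphic_intros) auto
qed

lemma laguerre_generating_function:
  assumes "norm s < 1"
  shows "(\<lambda>n. laguerre \<alpha> n x * s ^ n) sums
    ((1 - s) powr (- \<alpha> - 1) * exp (- (x * s) / (1 - s)))"
  using holomorphic_power_series[OF laguerre_gf_holomorphic[of \<alpha> x], of s] assms
  by (simp add: laguerre_def fps_expansion_def laguerre_gf_def)

definition kummer :: "complex \<Rightarrow> complex \<Rightarrow> complex \<Rightarrow> complex" where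
  "kummer \<nu> \<mu> z = (\<Sum>n. pochhammer \<nu> n / pochhammer \<mu> n * (z ^ n / fact n))"

(* rGamma is the entire function 1/Gamma, equal to 0 at the poles of Gamma. *)
definition parabolic_cylinder_D :: "complex \<Rightarrow> complex \<Rightarrow> complex" where
  "parabolic_cylinder_D \<nu> z =
     2 powr (\<nu> / 2) * exp (- (z ^ 2) / 4) *
     (of_real (sqrt pi) * rGamma (1 / 2 - \<nu> / 2) * kummer (- \<nu> / 2) (1 / 2) (z ^ 2 / 2)
      - of_real (sqrt (2 * pi)) * z * rGamma (- \<nu> / 2)
          * kummer (1 / 2 - \<nu> / 2) (3 / 2) (z ^ 2 / 2))"

end

(* For real nu > 0 one has D_{-nu}(z) = e^{-z^2/4} J(z) / Gamma(nu) with
   J(z) = \<integral>_0^\<infinity> t^{nu-1} e^{-t^2/2 - z t} dt.  Write J(z) J(z') as a double integral in (t, s), use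
   the coordinates q = t s, y = (t - s)/2, so that (t + s)/2 = sqrt (y^2 + q), and insert
     e^{-2 sqrt (a b)} / sqrt a = pi^{-1/2} \<integral>_0^\<infinity> w^{-1/2} e^{-a w - b/w} dw,  a = y^2 + q.
   The y- and q-integrals become a Gaussian and a Gamma integral; with
   W(w) = (1 + w)^{-nu} / sqrt (w (2 + w)) the result is
     J(z)^2 = Gamma(nu) \<integral>_0^\<infinity> W(w) e^{-z^2/w} dw            (z \<ge> 0),
     J(z) J(-z) = Gamma(nu) \<integral>_0^\<infinity> W(w) e^{z^2/(2+w)} dw.
   For s = 1/(1+w) the exponentials are the Laguerre generating function with superscript -1 at
   s and at -s, and expanding it gives the two series.

   The series converges only thanks to oscillation.  The partial sums of L_n^{-1}(x) and of
   (-1)^n L_n^{-1}(x) are bounded, by an energy (Sonin) argument for the differential equation in x.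
   The coefficients a_n satisfy a_n - a_{n+2} = a_n / (nu + n + 1), so along each parity class they
   have bounded variation and tend to 0, locally uniformly in nu.  Summation by parts thus gives
   locally uniform convergence, and both sides are entire in nu.  For nu = -m the series is
   finite, and both sides are entire in z. *)

theory Submission
  imports Defs "HOL-Probability.Distributions"
begin

section \<open>Laguerre polynomials\<close>

text \<open>All integrals up to the product formulas are integrals of nonnegative functions in
  \<open>ennreal\<close>: exchanges and substitutions need no integrability proof, and finiteness is
  read off closed forms. The price is positivity. Hence J is matched with D through cosh and sinh,
  whose series have no alternating signs. The formula for e^{-2 sqrt (a b)} / sqrt a fits because
  the Jacobian of (t, s) -> (y, q) leaves exactly 1 / sqrt (y^2 + q), and because a = y^2 + q then
  enters the exponent linearly, which separates y from q. The masses of the weights are not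
  integrated directly. Multiplying the weight for \<nu> by (1 + w)^{-n} gives the weight for \<nu> +
  n, and the product formula at z = 0 gives the mass J(0)^2 / Gamma \<mu> for parameter \<mu>.
  Duplication turns it into a multiple of a_n. Termwise integration meets s -> 1 as w -> 0, the
  boundary of the disc of the generating function. Boundedness of the partial sums serves there too:
  Abel's inequality turns it into domination. Steps of two in n are natural since Gamma ((1 + n +
  \<nu>) / 2) then shifts by one, making the ratio of coefficients rational.\<close>

definition laguerre_zero :: "nat \<Rightarrow> 'a::real_normed_field \<Rightarrow> 'a" where
  "laguerre_zero n x = (\<Sum>k\<le>n. of_nat (n choose k) * (- x) ^ k / fact k)"

text \<open>The coefficient of (-x)^j / j! in L_n^{-1} is binomial (n - 1, n - j), which is 0 at j =
  0 when n \<ge> 1. The sum is therefore indexed by j = k + 1, and n = 0 stands apart. The type is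
  generic because estimates and integrals are real while the continuation is complex.\<close>

definition laguerre_minus1 :: "nat \<Rightarrow> 'a::real_normed_field \<Rightarrow> 'a" where
  "laguerre_minus1 n x = (case n of 0 \<Rightarrow> 1 | Suc m \<Rightarrow>
     \<Sum>k\<le>m. of_nat (m choose k) * (- x) ^ Suc k / fact (Suc k))"

lemma laguerre_minus1_0 [simp]: "laguerre_minus1 0 x = 1"
  by (simp add: laguerre_minus1_def)

lemma laguerre_minus1_Suc: "laguerre_minus1 (Suc m) x = (\<Sum>k\<le>m. of_nat (m choose k) * (- x) ^ Suc k / fact (Suc k))"
  by (simp add: laguerre_minus1_def)

lemma laguerre_minus1_Suc_at_0 [simp]: "laguerre_minus1 (Suc m) 0 = 0"
  by (simp add: laguerre_minus1_Suc)

lemma laguerre_zero_0 [simp]: "laguerre_zero 0 x = 1"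
  by (simp add: laguerre_zero_def)

text \<open>Pascal's rule on the coefficients. It makes L^{-1} the difference of consecutive L^0, so
  the partial sums of one family are the members of the other.\<close>

lemma laguerre_zero_Suc: "laguerre_zero (Suc n) x = laguerre_zero n x + laguerre_minus1 (Suc n) x"
proof -
  have "laguerre_zero (Suc n) x = 1 + (\<Sum>k\<le>n. of_nat (Suc n choose Suc k) * (- x) ^ Suc k / fact (Suc k))"
    unfolding laguerre_zero_def by (subst sum.atMost_Suc_shift) simp
  also have "\<dots> = 1 + (\<Sum>k\<le>n. of_nat (n choose Suc k) * (- x) ^ Suc k / fact (Suc k)) + laguerre_minus1 (Suc n) x"
    by (simp add: laguerre_minus1_Suc sum.distrib [symmetric] ring_distribs add_divide_distrib add_ac
             del: power_Suc fact_Suc)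
  also have "1 + (\<Sum>k\<le>n. of_nat (n choose Suc k) * (- x) ^ Suc k / fact (Suc k)) =
      (\<Sum>k\<le>Suc n. of_nat (n choose k) * (- x) ^ k / fact k)"
    by (subst sum.atMost_Suc_shift) simp
  also have "\<dots> = laguerre_zero n x"
    by (simp add: laguerre_zero_def)
  finally show ?thesis .
qed

lemma laguerre_zero_at_0 [simp]: "laguerre_zero n 0 = 1"
  by (induction n) (auto simp: laguerre_zero_Suc)

lemma laguerre_zero_eq_sum_laguerre_minus1: "laguerre_zero n x = (\<Sum>j\<le>n. laguerre_minus1 j x)"
  by (induction n) (auto simp: laguerre_zero_Suc)

text \<open>Used twice: it is the recurrence that the Taylor coefficients of the generating function
  also satisfy, and it supplies a relation for the differential equation in x.\<close>

lemma laguerre_minus1_rec: "of_nat (Suc n) * laguerre_minus1 (Suc n) x = of_nat n * laguerre_minus1 n x - x * laguerre_zero n x"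
proof (cases n)
  case 0
  then show ?thesis by (simp add: laguerre_minus1_Suc)
next
  case (Suc m)
  \<comment> \<open>Here m = n - 1, and the identity rests on (n - k) C(n,k) = n C(n-1,k). The
    factor k + 1 in the last term cancels into (k + 1)!, which is how L_n^0 appears.\<close>
  have *: "of_nat (Suc n) * (of_nat (n choose k) :: 'a) = of_nat n * of_nat (m choose k) + of_nat (Suc k) * of_nat (n choose k)" for k
  proof -
    have "Suc n * (n choose k) = n * (m choose k) + Suc k * (n choose k)"
    proof (cases k)
      case (Suc j)
      have "n * (m choose k) = (n - k) * (n choose k)"
        using binomial_absorb_comp[of n k] \<open>n = Suc m\<close> by simp
      moreover have "k \<le> n \<or> n choose k = 0"
        by (cases "k \<le> n") auto
      ultimately show ?thesis
        by (auto simp flip: distrib_right)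
    qed (auto simp: \<open>n = Suc m\<close>)
    then show ?thesis
      by (metis of_nat_add of_nat_mult)
  qed
  have "of_nat (Suc n) * laguerre_minus1 (Suc n) x =
      (\<Sum>k\<le>n. (of_nat (Suc n) * of_nat (n choose k)) * ((- x) ^ Suc k / fact (Suc k)))"
    by (simp add: laguerre_minus1_Suc sum_distrib_left mult_ac del: power_Suc fact_Suc of_nat_Suc)
  also have "\<dots> = (\<Sum>k\<le>n. of_nat n * of_nat (m choose k) * ((- x) ^ Suc k / fact (Suc k))) +
      (\<Sum>k\<le>n. of_nat (n choose k) * (of_nat (Suc k) * ((- x) ^ Suc k / fact (Suc k))))"
    by (simp add: * ring_distribs sum.distrib mult_ac del: power_Suc fact_Suc of_nat_Suc)
  also have "(\<Sum>k\<le>n. of_nat n * of_nat (m choose k) * ((- x) ^ Suc k / fact (Suc k))) =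
      of_nat n * laguerre_minus1 n x"
    by (simp add: Suc laguerre_minus1_Suc sum_distrib_left mult_ac del: power_Suc fact_Suc of_nat_Suc)
  also have "(\<Sum>k\<le>n. of_nat (n choose k) * (of_nat (Suc k) * ((- x) ^ Suc k / fact (Suc k)))) =
      - x * laguerre_zero n x"
    unfolding laguerre_zero_def sum_distrib_left
    by (intro sum.cong refl) (simp add: field_simps del: of_nat_Suc)
  finally show ?thesis by simp
qed

lemma laguerre_minus1_Suc_deriv: "(laguerre_minus1 (Suc n) has_field_derivative - laguerre_zero n x) (at x within A)"
proof -
  have 1: "((\<lambda>x. of_nat (n choose k) * (- x) ^ Suc k / fact (Suc k)) has_field_derivative
      - (of_nat (n choose k) * (- x) ^ k / fact k)) (at x within A)" for k
    by (rule derivative_eq_intros refl | simp del: of_nat_Suc add: field_simps)+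
  have "((\<lambda>x. \<Sum>k\<le>n. of_nat (n choose k) * (- x) ^ Suc k / fact (Suc k)) has_field_derivative
      (\<Sum>k\<le>n. - (of_nat (n choose k) * (- x) ^ k / fact k))) (at x within A)"
    by (rule DERIV_sum[OF 1])
  then show ?thesis
    by (simp add: laguerre_minus1_Suc[abs_def] laguerre_zero_def sum_negf)
qed

lemma laguerre_zero_deriv: "(laguerre_zero n has_field_derivative - (\<Sum>j<n. laguerre_zero j x)) (at x within A)"
proof (induction n)
  case 0
  then show ?case by (simp add: laguerre_zero_0[abs_def])
next
  case (Suc n)
  show ?case
    unfolding laguerre_zero_Suc[abs_def]
    by (rule DERIV_cong, rule DERIV_add[OF Suc laguerre_minus1_Suc_deriv]) simp
qed

text \<open>The recurrence \<open>laguerre_minus1_rec\<close> telescopes. With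
  \<open>laguerre_zero_deriv\<close> it reads x (L_n^0)' = n L_n^{-1}, which closes the differential
  system for L_n^0 and L_{n+1}^{-1}.\<close>

lemma mult_sum_laguerre_zero: "x * (\<Sum>j<n. laguerre_zero j x) = - (of_nat n * laguerre_minus1 n x)"
proof (induction n)
  case (Suc n)
  then show ?case
    using laguerre_minus1_rec[of n x] by (simp add: ring_distribs algebra_simps del: of_nat_Suc)
qed simp

lemma laguerre_minus1_of_real: "laguerre_minus1 n (of_real x :: 'a::real_normed_field) = of_real (laguerre_minus1 n x)"
  by (cases n) (simp_all add: laguerre_minus1_Suc del: power_Suc fact_Suc)

text \<open>At \<alpha> = -1 the power factor is 1 on the disc, so f solves (1 - s)^2 f' = -x f. In
  Taylor coefficients this equation is a recurrence which, with initial value 1, determines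
  them.\<close>

lemma laguerre_eq_laguerre_minus1: "laguerre (-1) n x = laguerre_minus1 n x"
proof -
  define f where "f = laguerre_gf (-1) x"
  define F where "F = fps_expansion f 0"
  \<comment> \<open>At s = 1 the convention 0 powr 0 = 0 makes f differ from the
    exponential.\<close>
  have f_eq: "f s = exp (- (x * s) / (1 - s))" if "s \<noteq> 1" for s
    using that by (simp add: f_def laguerre_gf_def)
  have hol: "f holomorphic_on ball 0 1"
    unfolding f_def by (rule laguerre_gf_holomorphic)
  have F: "f has_fps_expansion F"
    unfolding F_def by (rule has_fps_expansion_fps_expansion[OF _ _ hol]) auto
  have ev: "eventually (\<lambda>s::complex. s \<in> ball 0 1) (nhds 0)"
    by (rule eventually_nhds_in_open) auto
  have F': "deriv f has_fps_expansion fps_deriv F"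
    by (rule has_fps_expansion_deriv[OF F])
  have dv: "deriv f s = - x / (1 - s)^2 * f s" if s: "s \<in> ball 0 1" for s
  proof -
    have s1: "s \<noteq> 1" using s by auto
    have "((\<lambda>s. exp (- (x * s) / (1 - s))) has_field_derivative (- x / (1 - s)^2 * f s)) (at s)"
      using s1 by (auto intro!: derivative_eq_intros simp: f_eq field_simps power2_eq_square)
    moreover have "eventually (\<lambda>s. s \<in> - {1}) (nhds s)"
      by (rule eventually_nhds_in_open) (use s1 in auto)
    then have "eventually (\<lambda>s. f s = exp (- (x * s) / (1 - s))) (nhds s)"
      by eventually_elim (simp add: f_eq)
    ultimately have "(f has_field_derivative (- x / (1 - s)^2 * f s)) (at s)"
      by (subst DERIV_cong_ev[OF refl _ refl])
    then show ?thesis by (rule DERIV_imp_deriv)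
  qed
  have "(\<lambda>s. (1 - s)^2 * deriv f s) has_fps_expansion (1 - fps_X)^2 * fps_deriv F"
    by (intro fps_expansion_intros F')
  moreover have "eventually (\<lambda>s. (1 - s)^2 * deriv f s = - x * f s) (nhds 0)"
    using ev by eventually_elim (auto simp: dv)
  ultimately have "(\<lambda>s. - x * f s) has_fps_expansion (1 - fps_X)^2 * fps_deriv F"
    by (subst (asm) has_fps_expansion_cong[OF _ refl])
  moreover have "(\<lambda>s. - x * f s) has_fps_expansion fps_const (- x) * F"
    by (intro fps_expansion_intros F)
  ultimately have eq: "(1 - fps_X)^2 * fps_deriv F = fps_const (- x) * F"
    using fps_expansion_unique_complex by blast
  \<comment> \<open>Multiplying by the geometric series removes one factor 1 - X and turns F into
    its partial sums, the shape in which \<open>laguerre_minus1_rec\<close> is stated.\<close>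
  have eq1: "(1 - fps_X) * fps_deriv F = fps_const (- x) * (F * Abs_fps (\<lambda>_. 1))"
  proof -
    have inv: "(1 - fps_X) * Abs_fps (\<lambda>_. 1) = (1 :: complex fps)"
      by (rule fps_ext) (auto simp: ring_distribs fps_X_mult_nth left_diff_distrib)
    have "fps_const (- x) * (F * Abs_fps (\<lambda>_. 1)) = (1 - fps_X)^2 * fps_deriv F * Abs_fps (\<lambda>_. 1)"
      unfolding eq by (simp add: mult_ac)
    also have "\<dots> = (1 - fps_X) * fps_deriv F * ((1 - fps_X) * Abs_fps (\<lambda>_. 1))"
      by (simp add: power2_eq_square mult_ac)
    finally show ?thesis by (simp add: inv)
  qed
  have rec: "of_nat (Suc n) * fps_nth F (Suc n) = of_nat n * fps_nth F n - x * (\<Sum>j\<le>n. fps_nth F j)" for n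
  proof -
    have "fps_nth (F * Abs_fps (\<lambda>_. 1)) n = (\<Sum>j\<le>n. fps_nth F j)"
      by (simp add: fps_mult_nth atMost_atLeast0)
    then have R: "fps_nth (fps_const (- x) * (F * Abs_fps (\<lambda>_. 1))) n = - x * (\<Sum>j\<le>n. fps_nth F j)"
      by (simp only: fps_mult_left_const_nth)
    have "fps_nth ((1 - fps_X) * fps_deriv F) n = of_nat (Suc n) * fps_nth F (Suc n) - of_nat n * fps_nth F n"
      by (cases n) (auto simp: left_diff_distrib fps_X_mult_nth)
    then have "of_nat (Suc n) * fps_nth F (Suc n) - of_nat n * fps_nth F n = - x * (\<Sum>j\<le>n. fps_nth F j)"
      using R by (simp only: eq1)
    then show ?thesis
      by (simp only: diff_eq_eq) simp
  qed
  have F0: "fps_nth F 0 = 1"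
    using has_fps_expansion_imp_0_eq_fps_nth_0[OF F] by (simp add: f_eq)
  have "fps_nth F n = laguerre_minus1 n x"
  proof (induction n rule: less_induct)
    case (less n)
    show ?case
    proof (cases n)
      case 0
      then show ?thesis by (simp add: F0)
    next
      case (Suc m)
      have "of_nat (Suc m) * fps_nth F (Suc m) = of_nat (Suc m) * laguerre_minus1 (Suc m) x"
        unfolding rec laguerre_minus1_rec laguerre_zero_eq_sum_laguerre_minus1 using less Suc by simp
      then show ?thesis
        using Suc by (simp del: of_nat_Suc)
    qed
  qed
  then show ?thesis
    by (simp add: laguerre_def F_def f_def)
qed

section \<open>Bounds on the partial sums of Laguerre polynomials\<close>

text \<open>The energy controls v only while N / t - 1/4 is nonnegative, hence the range up to 4 N
  with N = n + 1. The bound |v| \<le> 1 integrates to |u| \<le> x, and the damped L_n^0 is -v - u /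
  2.\<close>

lemma laguerre_zero_bound:
  fixes x :: real
  assumes x: "0 \<le> x" "x \<le> 4 * real (Suc n)"
  shows "\<bar>exp (- x / 2) * laguerre_zero n x\<bar> \<le> 1 + x / 2"
proof -
  define N where "N = Suc n"
  define u where "u = (\<lambda>t::real. exp (- t / 2) * laguerre_minus1 N t)"
  define v where "v = (\<lambda>t::real. - exp (- t / 2) * (laguerre_minus1 N t / 2 + laguerre_zero n t))"
  \<comment> \<open>\<open>u'' = (1/4 - N/t) u\<close>, so the Sonin energy \<open>S\<close> decreases, from the value 1 at \<open>0+\<close>\<close>
  define S where "S = (\<lambda>t. (v t)^2 + (real N / t - 1 / 4) * (u t)^2)"
  have [derivative_intros]: "((\<lambda>t. laguerre_minus1 N (g t)) has_field_derivative - laguerre_zero n (g t) * g') (at t within A)"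
    if "(g has_field_derivative g') (at t within A)" for g :: "real \<Rightarrow> real" and g' t A
    unfolding N_def by (rule DERIV_chain2[OF laguerre_minus1_Suc_deriv that])
  have [derivative_intros]: "((\<lambda>t. laguerre_zero n (g t)) has_field_derivative - (\<Sum>j<n. laguerre_zero j (g t)) * g') (at t within A)"
    if "(g has_field_derivative g') (at t within A)" for g :: "real \<Rightarrow> real" and g' t A
    by (rule DERIV_chain2[OF laguerre_zero_deriv that])
  have du: "(u has_field_derivative v t) (at t within A)" for t A
    unfolding u_def v_def
    by (rule derivative_eq_intros refl | simp add: algebra_simps)+
  \<comment> \<open>\<open>s\<close> and \<open>l\<close> express everything through L_n^{-1} and
    L_N^{-1}; the former then cancels.\<close>
  have dv: "(v has_field_derivative (1 / 4 - real N / t) * u t) (at t within A)" if "t \<noteq> 0" for t A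
  proof -
    have s: "(\<Sum>j<n. laguerre_zero j t) = - (of_nat n * laguerre_minus1 n t) / t"
      using mult_sum_laguerre_zero[of t n] that by (simp add: field_simps)
    have l: "laguerre_zero n t = (real n * laguerre_minus1 n t - real N * laguerre_minus1 N t) / t"
      using laguerre_minus1_rec[of n t] that unfolding N_def by (simp add: field_simps)
    have "(v has_field_derivative exp (- t / 2) * (laguerre_minus1 N t / 4 + laguerre_zero n t + (\<Sum>j<n. laguerre_zero j t))) (at t within A)"
      unfolding v_def
      by (rule derivative_eq_intros refl | simp add: field_simps)+
    also have "exp (- t / 2) * (laguerre_minus1 N t / 4 + laguerre_zero n t + (\<Sum>j<n. laguerre_zero j t)) = (1 / 4 - real N / t) * u t"
      unfolding s l u_def using that by (simp add: field_simps)
    finally show ?thesis .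
  qed
  \<comment> \<open>By the equation for u the terms containing u v cancel. Only the derivative of N
    / t survives, and it is negative.\<close>
  have dS: "(S has_field_derivative - real N * (u t)^2 / t^2) (at t)" if "t > 0" for t
    unfolding S_def power2_eq_square using that
    by - (rule derivative_eq_intros du dv refl | simp add: algebra_simps)+
  have u0: "u 0 = 0" and v0: "v 0 = - 1"
    by (simp_all add: u_def v_def N_def)
  have S_anti: "S b \<le> S a" if "0 < a" "a \<le> b" for a b
    using that by (intro DERIV_nonpos_imp_nonincreasing[of a b S])
       (auto intro!: exI[of _ "- real N * (u t)^2 / t^2" for t] dS)
  have cont_u: "(u \<longlongrightarrow> u 0) (at_right 0)" and cont_v: "(v \<longlongrightarrow> v 0) (at_right 0)"
  proof -
    have "isCont u 0" using du[of 0 UNIV] by (rule DERIV_isCont)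
    then show "(u \<longlongrightarrow> u 0) (at_right 0)"
      unfolding isCont_def by (rule filterlim_mono) (auto intro: at_le)
    have "isCont v 0" unfolding v_def N_def
      by (intro continuous_intros DERIV_isCont[OF laguerre_minus1_Suc_deriv] DERIV_isCont[OF laguerre_zero_deriv]) auto
    then show "(v \<longlongrightarrow> v 0) (at_right 0)"
      unfolding isCont_def by (rule filterlim_mono) (auto intro: at_le)
  qed
  \<comment> \<open>The singular term is written N (u / t) u: the quotient u / t tends to v 0 = -1
    while u tends to 0.\<close>
  have S_lim: "(S \<longlongrightarrow> 1) (at_right 0)"
  proof -
    have "((\<lambda>t. u t / t) \<longlongrightarrow> v 0) (at_right 0)"
      using du[of 0 "{0<..}"] by (simp add: has_field_derivative_iff u0)
    then have "((\<lambda>t. (v t)^2 + real N * (u t / t) * u t - (u t)^2 / 4) \<longlongrightarrow> (v 0)^2 + real N * v 0 * u 0 - (u 0)^2 / 4) (at_right 0)"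
      by (intro tendsto_intros cont_u cont_v) auto
    moreover have "(\<lambda>t. (v t)^2 + real N * (u t / t) * u t - (u t)^2 / 4) = S"
      by (auto simp: S_def fun_eq_iff algebra_simps power2_eq_square)
    ultimately show ?thesis by (simp add: u0 v0)
  qed
  have S_le: "S t \<le> 1" if "t > 0" for t
  proof (rule tendsto_lowerbound[OF S_lim])
    show "eventually (\<lambda>a. S t \<le> S a) (at_right 0)"
      using eventually_at_right_real[OF that] by eventually_elim (auto intro: S_anti)
  qed simp
  have v_le: "\<bar>v t\<bar> \<le> 1" if t: "0 \<le> t" "t \<le> 4 * real N" for t
  proof (cases "t = 0")
    case False
    with t have "0 \<le> (real N / t - 1 / 4) * (u t)^2"
      by (intro mult_nonneg_nonneg) (auto simp: field_simps)
    then have "(v t)^2 \<le> 1"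
      using S_le[of t] t False unfolding S_def by linarith
    then show ?thesis by (simp add: abs_square_le_1)
  qed (simp add: v0)
  have "\<bar>u x - u 0\<bar> \<le> 1 * \<bar>x - 0\<bar>"
  proof -
    have "norm (u x - u 0) \<le> 1 * norm (x - 0)"
      by (rule field_differentiable_bound[of "{0..x}" u v])
         (use x in \<open>auto intro!: du v_le simp: N_def\<close>)
    then show ?thesis by simp
  qed
  then have "\<bar>u x\<bar> \<le> x" using x u0 by simp
  moreover have "\<bar>v x\<bar> \<le> 1" using x by (intro v_le) (auto simp: N_def)
  moreover have "exp (- x / 2) * laguerre_zero n x = - v x - u x / 2"
    by (simp add: u_def v_def algebra_simps)
  ultimately show ?thesis by (auto simp: abs_le_iff)
qed

text \<open>These partial sums are L_n^0. Once n \<ge> x, the point x lies in the range of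
  \<open>laguerre_zero_bound\<close>; the remaining indices are finite in number.\<close>

lemma Bseq_sum_laguerre_minus1:
  assumes "x \<ge> 0"
  shows "Bseq (\<lambda>n. \<Sum>k\<le>n. laguerre_minus1 k x :: real)"
proof -
  have "eventually (\<lambda>n. norm (laguerre_zero n x) \<le> norm (exp (x / 2) * (1 + x / 2))) sequentially"
    using eventually_ge_at_top[of "nat \<lceil>x\<rceil>"]
  proof eventually_elim
    case (elim n)
    then have "x \<le> 4 * real (Suc n)" using assms by (simp add: nat_ceiling_le_eq)
    from laguerre_zero_bound[OF assms this] have "exp (- x / 2) * \<bar>laguerre_zero n x\<bar> \<le> 1 + x / 2"
      by (simp add: abs_mult)
    then have "exp (x / 2) * (exp (- x / 2) * \<bar>laguerre_zero n x\<bar>) \<le> exp (x / 2) * (1 + x / 2)"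
      by (intro mult_left_mono) auto
    also have "exp (x / 2) * (exp (- x / 2) * \<bar>laguerre_zero n x\<bar>) = \<bar>laguerre_zero n x\<bar>"
      by (simp add: mult.assoc [symmetric] exp_add [symmetric])
    finally show ?case using assms by (simp add: abs_mult)
  qed
  then have "Bseq (\<lambda>n. laguerre_zero n x)"
    by (rule Bseq_eventually_mono) auto
  then show ?thesis by (simp add: laguerre_zero_eq_sum_laguerre_minus1)
qed

text \<open>The weight exp (-t/2) makes the derivative telescope: apart from the weight, the term of
  index n + 1 adds (-1)^n (L_n^0 + L_{n+1}^0) / 2. The alternating sums thus inherit a bound from
  L_n^0 by integration from 0, without a second energy argument.\<close>

lemma alternating_sum_laguerre_minus1_deriv:
  fixes x :: real
  shows "((\<lambda>t. exp (- t / 2) * (\<Sum>k\<le>n. (- 1) ^ k * laguerre_minus1 k t)) has_field_derivative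
     - (1 / 2) * (- 1) ^ n * (exp (- x / 2) * laguerre_zero n x)) (at x within A)"
proof (induction n)
  case 0
  show ?case by (rule derivative_eq_intros refl | simp)+
next
  case (Suc n)
  have *: "((\<lambda>t. exp (- t / 2) * ((- 1) ^ Suc n * laguerre_minus1 (Suc n) t)) has_field_derivative
     exp (- x / 2) * ((- 1) ^ Suc n * (- laguerre_zero n x)) - exp (- x / 2) / 2 * ((- 1) ^ Suc n * laguerre_minus1 (Suc n) x)) (at x within A)"
    by (rule derivative_eq_intros refl laguerre_minus1_Suc_deriv | simp add: algebra_simps)+
  show ?case
    unfolding sum.atMost_Suc distrib_left
    by (rule DERIV_cong, rule DERIV_add[OF Suc *]) (simp add: laguerre_zero_Suc algebra_simps)
qed

lemma Bseq_alternating_sum_laguerre_minus1: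
  assumes "x \<ge> 0"
  shows "Bseq (\<lambda>n. \<Sum>k\<le>n. (- 1) ^ k * laguerre_minus1 k x :: real)"
proof -
  have "eventually (\<lambda>n. norm (\<Sum>k\<le>n. (- 1) ^ k * laguerre_minus1 k x) \<le> norm (exp (x / 2) * (1 + (1 + x / 2) * x))) sequentially"
    using eventually_ge_at_top[of "nat \<lceil>x\<rceil>"]
  proof eventually_elim
    case (elim n)
    then have n: "x \<le> 4 * real (Suc n)" using assms by (simp add: nat_ceiling_le_eq)
    define M where "M = (\<lambda>t. \<Sum>k\<le>n. (- 1) ^ k * laguerre_minus1 k t :: real)"
    have "norm (exp (- x / 2) * M x - exp (- 0 / 2) * M 0) \<le> (1 + x / 2) * norm (x - 0)"
    proof (rule field_differentiable_bound)
      fix t assume t: "t \<in> {0..x}"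
      show "((\<lambda>t. exp (- t / 2) * M t) has_field_derivative
         - (1 / 2) * (- 1) ^ n * (exp (- t / 2) * laguerre_zero n t)) (at t within {0..x})"
        unfolding M_def by (rule alternating_sum_laguerre_minus1_deriv)
      have "\<bar>exp (- t / 2) * laguerre_zero n t\<bar> \<le> 1 + t / 2"
        using t n by (intro laguerre_zero_bound) auto
      also have "\<dots> \<le> 1 + x / 2" using t by simp
      finally show "norm (- (1 / 2) * (- 1) ^ n * (exp (- t / 2) * laguerre_zero n t)) \<le> 1 + x / 2"
        using assms by (simp add: abs_mult power_abs)
    qed (use assms in auto)
    moreover have "M 0 = 1"
      unfolding M_def by (subst sum.atMost_shift) simp
    ultimately have "exp (- x / 2) * \<bar>M x\<bar> \<le> 1 + (1 + x / 2) * x"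
      using assms by (auto simp: abs_if split: if_splits simp: mult_less_0_iff)
    then have "exp (x / 2) * (exp (- x / 2) * \<bar>M x\<bar>) \<le> exp (x / 2) * (1 + (1 + x / 2) * x)"
      by (intro mult_left_mono) auto
    also have "exp (x / 2) * (exp (- x / 2) * \<bar>M x\<bar>) = \<bar>M x\<bar>"
      by (simp add: mult.assoc [symmetric] exp_add [symmetric])
    finally show ?case using assms by (simp add: abs_mult M_def)
  qed
  then show ?thesis
    by (rule Bseq_eventually_mono) auto
qed

section \<open>Gamma quotients and the coefficients\<close>

text \<open>The quotient Gamma w / Gamma (w + 1/2). At w = (\<nu> + n) / 2 the coefficients of the
  series reduce to it, up to a factor that is entire in \<nu> and free of n.\<close>

definition gamma_ratio :: "complex \<Rightarrow> complex" where
  "gamma_ratio w = Gamma w * rGamma (w + 1 / 2)"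

definition gamma_ratio_real :: "real \<Rightarrow> real" where
  "gamma_ratio_real w = Gamma w * rGamma (w + 1 / 2)"

text \<open>By Gauss's product the quotient is the limit of n^{-1/2} times the product of 1 + (1/2)
  / (w + k), and |w + k| \<ge> s + k. So the value at a real point dominates the half plane to its
  right. Both monotonicity and the locally uniform bounds in \<nu> come from this.\<close>

lemma norm_gamma_ratio_le:
  assumes s: "0 < s" "s \<le> Re w"
  shows "norm (gamma_ratio w) \<le> gamma_ratio_real s"
proof -
  define P where "P = (\<lambda>n. Gamma_series w n * rGamma_series (w + 1 / 2) n)"
  define Q where "Q = (\<lambda>n. Gamma_series s n * rGamma_series (s + 1 / 2) n)"
  have nz: "w + of_nat k \<noteq> 0" for k
    using s by (auto simp: complex_eq_iff)
  have P: "P \<longlonglongrightarrow> gamma_ratio w"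
    unfolding P_def gamma_ratio_def by (intro tendsto_mult Gamma_series_LIMSEQ rGamma_series_LIMSEQ)
  have Q: "Q \<longlonglongrightarrow> gamma_ratio_real s"
    unfolding Q_def gamma_ratio_real_def by (intro tendsto_mult Gamma_series_LIMSEQ rGamma_series_LIMSEQ)
  have P_eq: "P n = (\<Prod>k\<le>n. 1 + (1 / 2) / (w + of_nat k)) * exp (- of_real (ln (of_nat n)) / 2)" for n
  proof -
    have "P n = (\<Prod>k\<le>n. (w + 1 / 2 + of_nat k) / (w + of_nat k)) * (exp (w * of_real (ln (of_nat n))) / exp ((w + 1 / 2) * of_real (ln (of_nat n))))"
      by (simp add: P_def Gamma_series_def rGamma_series_def pochhammer_prod prod_dividef lessThan_Suc_atMost atLeast0LessThan atLeast0AtMost)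
    also have "exp (w * of_real (ln (of_nat n))) / exp ((w + 1 / 2) * of_real (ln (of_nat n))) = exp (- of_real (ln (of_nat n)) / 2)"
      by (simp add: exp_diff [symmetric] algebra_simps)
    also have "(\<Prod>k\<le>n. (w + 1 / 2 + of_nat k) / (w + of_nat k)) = (\<Prod>k\<le>n. 1 + (1 / 2) / (w + of_nat k))"
    proof (intro prod.cong refl)
      fix k
      show "(w + 1 / 2 + of_nat k) / (w + of_nat k) = 1 + (1 / 2) / (w + of_nat k)"
        using add_divide_distrib[of "w + of_nat k" "1 / 2" "w + of_nat k"] nz[of k] by (simp add: add_ac)
    qed
    finally show ?thesis .
  qed
  have Q_eq: "Q n = (\<Prod>k\<le>n. 1 + (1 / 2) / (s + of_nat k)) * exp (- (ln (of_nat n)) / 2)" for n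
  proof -
    have "Q n = (\<Prod>k\<le>n. (s + 1 / 2 + of_nat k) / (s + of_nat k)) * (exp (s * of_real (ln (of_nat n))) / exp ((s + 1 / 2) * of_real (ln (of_nat n))))"
      by (simp add: Q_def Gamma_series_def rGamma_series_def pochhammer_prod prod_dividef lessThan_Suc_atMost atLeast0LessThan atLeast0AtMost)
    also have "exp (s * of_real (ln (of_nat n))) / exp ((s + 1 / 2) * of_real (ln (of_nat n))) = exp (- (ln (of_nat n)) / 2)"
      by (simp add: exp_diff [symmetric] algebra_simps)
    also have "(\<Prod>k\<le>n. (s + 1 / 2 + of_nat k) / (s + of_nat k)) = (\<Prod>k\<le>n. 1 + (1 / 2) / (s + of_nat k))"
      by (intro prod.cong refl) (use s in \<open>simp add: field_simps add_pos_nonneg\<close>)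
    finally show ?thesis .
  qed
  have "norm (P n) \<le> Q n" for n
  proof -
    have "norm (1 + (1 / 2) / (w + of_nat k)) \<le> 1 + (1 / 2) / (s + of_nat k)" for k
    proof -
      have "s + of_nat k \<le> Re (w + of_nat k)" using s by simp
      also have "\<dots> \<le> norm (w + of_nat k)" by (rule complex_Re_le_cmod)
      finally have "(1 / 2) / norm (w + of_nat k) \<le> (1 / 2) / (s + of_nat k)"
        using s by (intro divide_left_mono) (auto intro!: mult_pos_pos add_pos_nonneg simp: nz)
      then show ?thesis
        by (intro order.trans[OF norm_triangle_ineq]) (simp add: norm_divide del: divide_divide_eq_left)
    qed
    then show ?thesis
      unfolding P_eq Q_eq norm_mult prod_norm [symmetric]
      by (intro mult_mono prod_mono prod_nonneg) (use s in \<open>auto\<close>)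
  qed
  then show ?thesis
    by (intro LIMSEQ_le[OF tendsto_norm[OF P] Q]) auto
qed

lemma gamma_ratio_of_real: "gamma_ratio (of_real w) = of_real (gamma_ratio_real w)"
  using rGamma_complex_of_real[of "w + 1 / 2"]
  by (simp add: gamma_ratio_def gamma_ratio_real_def Gamma_complex_of_real)

lemma gamma_ratio_real_pos: "w > 0 \<Longrightarrow> gamma_ratio_real w > 0"
  by (simp add: gamma_ratio_real_def rGamma_inverse_Gamma Gamma_real_pos)

lemma gamma_ratio_real_antimono: "0 < a \<Longrightarrow> a \<le> b \<Longrightarrow> gamma_ratio_real b \<le> gamma_ratio_real a"
  using norm_gamma_ratio_le[of a "of_real b"] gamma_ratio_real_pos[of b]
  by (simp add: gamma_ratio_of_real)

lemma gamma_ratio_real_plus1: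
  assumes "w > 0"
  shows "gamma_ratio_real (w + 1) = gamma_ratio_real w * (w / (w + 1 / 2))"
proof -
  have "Gamma (w + 1) = w * Gamma w"
    by (rule Gamma_plus1) (use assms in \<open>auto elim!: nonpos_Ints_cases\<close>)
  moreover have "Gamma (w + 1 / 2 + 1) = (w + 1 / 2) * Gamma (w + 1 / 2)"
    by (rule Gamma_plus1) (use assms in \<open>auto elim!: nonpos_Ints_cases\<close>)
  moreover have "Gamma (w + 1 / 2) > 0"
    using assms by (intro Gamma_real_pos) auto
  moreover have "w + 1 + 1 / 2 = w + 1 / 2 + 1"
    by simp
  ultimately  show ?thesis
    using assms by (simp only: gamma_ratio_real_def rGamma_inverse_Gamma) (simp add: divide_simps)
qed

text \<open>The values at v and v + 1/2 multiply to Gamma v / Gamma (v + 1) = 1 / v. By monotonicity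
  this product is at least the square of the second value, so the quotient at w is at most (w -
  1/2)^{-1/2}.\<close>

lemma gamma_ratio_real_tendsto_0: "(gamma_ratio_real \<longlongrightarrow> 0) at_top"
proof -
  have le: "gamma_ratio_real w \<le> sqrt (1 / (w - 1 / 2))" if "w > 1 / 2" for w
  proof -
    define v where "v = w - 1 / 2"
    have v: "v > 0" "w = v + 1 / 2" using that by (auto simp: v_def)
    have "(gamma_ratio_real w)^2 \<le> gamma_ratio_real v * gamma_ratio_real w"
      using v gamma_ratio_real_antimono[of v w] gamma_ratio_real_pos[of w]
      by (simp add: power2_eq_square)
    also have "\<dots> = Gamma v * rGamma (v + 1)"
    proof -
      have "gamma_ratio_real w = Gamma (v + 1 / 2) * rGamma (v + 1)"
        by (simp add: gamma_ratio_real_def v(2) add.assoc)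
      then show ?thesis
        using v(1) less_imp_neq[OF Gamma_real_pos[of "v + 1 / 2"]]
        by (simp add: gamma_ratio_real_def[of v] rGamma_inverse_Gamma)
    qed
    also have "\<dots> = 1 / v"
    proof -
      have "Gamma (v + 1) = v * Gamma v"
        by (rule Gamma_plus1) (use v(1) in \<open>auto elim!: nonpos_Ints_cases\<close>)
      then show ?thesis
        using v(1) less_imp_neq[OF Gamma_real_pos[of v]] by (simp add: rGamma_inverse_Gamma field_simps)
    qed
    finally show ?thesis by (intro real_le_rsqrt) (simp add: v_def)
  qed
  have "((\<lambda>w::real. sqrt (1 / (w - 1 / 2))) \<longlongrightarrow> 0) at_top"
    by real_asymp
  moreover have "eventually (\<lambda>w. norm (gamma_ratio_real w) \<le> sqrt (1 / (w - 1 / 2))) at_top"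
    using eventually_gt_at_top[of "1/2"]
    by eventually_elim (use le in \<open>auto simp: abs_of_pos gamma_ratio_real_pos\<close>)
  ultimately show ?thesis
    by (intro Lim_null_comparison[of gamma_ratio_real])
qed

section \<open>Coefficients of the two series\<close>

definition product_coeff :: "nat \<Rightarrow> complex \<Rightarrow> complex" where
  "product_coeff n \<nu> = 2 powr (- \<nu> - of_nat n) * pochhammer \<nu> n * rGamma ((1 + of_nat n + \<nu>) / 2) ^ 2"

text \<open>With w = (\<nu> + n) / 2 the Pochhammer symbol is Gamma (2 w) / Gamma \<nu>. Duplication
  splits Gamma (2 w), and Gamma (w + 1/2) cancels one of the two reciprocal factors. Writing
  \<open>rGamma \<nu>\<close> keeps the formula valid at nonpositive integers \<nu>, provided n is
  large enough.\<close>

lemma product_coeff_eq_gamma_ratio: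
  assumes "Re \<nu> + real n > 0"
  shows "product_coeff n \<nu> = rGamma \<nu> / (2 * of_real (sqrt pi)) * gamma_ratio ((\<nu> + of_nat n) / 2)"
proof -
  define w where "w = (\<nu> + of_nat n) / 2"
  have w: "Re w > 0" using assms by (simp add: w_def)
  have np: "z \<notin> \<int>\<^sub>\<le>\<^sub>0" if "Re z > 0" for z :: complex
    using that by (auto elim!: nonpos_Ints_cases)
  have np': "w \<notin> \<int>\<^sub>\<le>\<^sub>0" "w + 1/2 \<notin> \<int>\<^sub>\<le>\<^sub>0" "2 * w \<notin> \<int>\<^sub>\<le>\<^sub>0"
    using w by (auto intro!: np)
  have nz: "Gamma w \<noteq> 0" "Gamma (w + 1 / 2) \<noteq> 0" "Gamma (2 * w) \<noteq> 0"
    using np' by (auto simp: Gamma_eq_zero_iff)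
  have poch: "pochhammer \<nu> n = rGamma \<nu> * Gamma (2 * w)"
  proof -
    have "2 * w = \<nu> + of_nat n" by (simp add: w_def)
    then show ?thesis
      using pochhammer_rGamma[of \<nu> n] nz(3) by (simp add: rGamma_inverse_Gamma[of "\<nu> + of_nat n"])
  qed
  have dup: "Gamma w * Gamma (w + 1 / 2) = exp ((1 - 2 * w) * of_real (ln 2)) * of_real (sqrt pi) * Gamma (2 * w)"
    using Gamma_legendre_duplication[of w] np' by simp
  have "exp ((1 - 2 * w) * of_real (ln 2)) = 2 * 2 powr (- 2 * w)"
  proof -
    have "Ln 2 = of_real (ln 2)" using Ln_of_real[of 2] by simp
    moreover have "exp (of_real (ln 2)) = (2::complex)" by (simp add: exp_of_real)
    moreover have "exp ((1 - 2 * w) * L) = exp L * exp (- 2 * w * L)" for L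
      by (simp add: exp_add [symmetric] algebra_simps)
    ultimately show ?thesis by (simp add: powr_def)
  qed
  then have dup': "2 powr (- 2 * w) * Gamma (2 * w) = Gamma w * Gamma (w + 1 / 2) / (2 * of_real (sqrt pi))"
    using dup by (simp add: field_simps)
  have "product_coeff n \<nu> = rGamma \<nu> * (2 powr (- 2 * w) * Gamma (2 * w)) * rGamma (w + 1 / 2) ^ 2"
    unfolding product_coeff_def poch by (simp add: w_def add_divide_distrib add_ac)
  also have "\<dots> = rGamma \<nu> / (2 * of_real (sqrt pi)) * gamma_ratio w"
    unfolding dup' using nz by (simp add: gamma_ratio_def rGamma_inverse_Gamma power2_eq_square field_simps)
  finally show ?thesis by (simp add: w_def)
qed

text \<open>With w = (1 + n + \<nu>) / 2, passing from n to n + 2 moves the argument of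
  \<open>rGamma\<close> from w to w + 1 and multiplies the coefficient by (2 w - 1) / (2 w).\<close>

lemma product_coeff_step:
  assumes "\<nu> + of_nat n + 1 \<noteq> 0"
  shows "product_coeff n \<nu> - product_coeff (Suc (Suc n)) \<nu> = product_coeff n \<nu> / (\<nu> + of_nat n + 1)"
proof -
  define w where "w = (1 + of_nat n + \<nu>) / 2"
  have w: "w \<noteq> 0" using assms by (auto simp: w_def add_ac)
  have r: "rGamma w = w * rGamma (w + 1)"
    by (rule rGamma_plus1 [symmetric])
  have p: "2 powr (- \<nu> - of_nat (Suc (Suc n))) = 2 powr (- \<nu> - of_nat n) / (4::complex)"
  proof -
    have "2 powr (- \<nu> - of_nat (Suc (Suc n))) = 2 powr (- \<nu> - of_nat n - 2 :: complex)"
      by (simp add: algebra_simps)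
    also have "\<dots> = 2 powr (- \<nu> - of_nat n) / 4"
      by (subst powr_diff) (simp add: powr_numeral)
    finally show ?thesis .
  qed
  have "product_coeff n \<nu> = 2 powr (- \<nu> - of_nat n) * pochhammer \<nu> n * w ^ 2 * rGamma (w + 1) ^ 2"
    unfolding product_coeff_def w_def [symmetric] by (subst r) (simp add: power_mult_distrib)
  moreover have "product_coeff (Suc (Suc n)) \<nu> =
      2 powr (- \<nu> - of_nat n) / 4 * (pochhammer \<nu> n * (\<nu> + of_nat n) * (\<nu> + of_nat n + 1)) * rGamma (w + 1) ^ 2"
    unfolding product_coeff_def p by (simp add: pochhammer_rec' w_def add_divide_distrib add_ac mult_ac)
  moreover have "\<nu> + of_nat n = 2 * w - 1" "\<nu> + of_nat n + 1 = 2 * w"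
    by (simp_all add: w_def field_simps)
  ultimately show ?thesis
    using w by (simp only:) (simp add: divide_simps, simp add: algebra_simps power2_eq_square)
qed

lemma product_coeff_holomorphic: "product_coeff n holomorphic_on A"
proof -
  have "(\<lambda>\<nu>::complex. pochhammer \<nu> n) holomorphic_on A"
    unfolding pochhammer_prod by (intro holomorphic_intros)
  then show ?thesis
    unfolding product_coeff_def[abs_def] by (intro holomorphic_intros) auto
qed

section \<open>Holomorphy in the parameter\<close>

lemma sum_by_parts:
  fixes f c :: "nat \<Rightarrow> 'a::comm_ring"
  shows "(\<Sum>j<J. f j * c j) = (\<Sum>j<J. (\<Sum>i<Suc j. f i) * (c j - c (Suc j))) + (\<Sum>i<J. f i) * c J"
  by (induction J) (auto simp: algebra_simps)

text \<open>On the disc the differences of the coefficients are eventually dominated by those of a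
  real decreasing sequence, and these telescope: this is the Weierstrass majorant. The boundary term
  of the summation by parts vanishes uniformly because that sequence tends to 0. \<open>r\<close>
  selects the parity class.\<close>

lemma uniform_limit_parity_sum:
  fixes f :: "nat \<Rightarrow> complex"
  assumes C: "\<And>J. norm (\<Sum>i<J. f i) \<le> C"
  shows "uniform_limit (cball 0 R) (\<lambda>J \<nu>. \<Sum>j<J. f j * product_coeff (2 * j + r) \<nu>)
     (\<lambda>\<nu>. \<Sum>j. (\<Sum>i<Suc j. f i) * (product_coeff (2 * j + r) \<nu> - product_coeff (2 * Suc j + r) \<nu>)) sequentially"
proof (cases "R \<ge> 0")
  case False
  then show ?thesis by (simp add: uniform_limit_on_empty)
next
  case R: True
  define c where "c = (\<lambda>j. product_coeff (2 * j + r))"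
  \<comment> \<open>The leftmost point -R of the disc gives the largest Gamma quotient, by
    \<open>norm_gamma_ratio_le\<close>.\<close>
  define \<beta> where "\<beta> = (\<lambda>j. gamma_ratio_real ((2 * real j + real r - R) / 2))"
  define K where "K = cball (0::complex) R"
  have "compact ((\<lambda>\<nu>. rGamma \<nu> / (2 * of_real (sqrt pi))) ` K)"
    unfolding K_def by (intro compact_continuous_image holomorphic_on_imp_continuous_on holomorphic_intros) auto
  then obtain B where B: "norm (rGamma \<nu> / (2 * of_real (sqrt pi))) \<le> B" if "\<nu> \<in> K" for \<nu>
    by (meson bounded_iff compact_imp_bounded image_eqI)
  have B0: "B \<ge> 0"
    using B[of 0] R by (simp add: K_def)
  have C0: "C \<ge> 0"
    using C[of 0] by simp
  have c_le: "norm (c j \<nu>) \<le> B * \<beta> j" if j: "real j > R" and \<nu>: "\<nu> \<in> K" for j \<nu>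
  proof -
    have re: "Re \<nu> \<ge> - R"
      using \<nu> abs_Re_le_cmod[of \<nu>] by (auto simp: K_def)
    have "c j \<nu> = rGamma \<nu> / (2 * of_real (sqrt pi)) * gamma_ratio ((\<nu> + of_nat (2 * j + r)) / 2)"
      unfolding c_def by (rule product_coeff_eq_gamma_ratio) (use j re R in auto)
    also have "norm \<dots> \<le> B * \<beta> j"
      unfolding norm_mult \<beta>_def
      by (intro mult_mono B \<nu> norm_gamma_ratio_le) (use B0 j re R in auto)
    finally show ?thesis .
  qed
  have d_le: "norm (c j \<nu> - c (Suc j) \<nu>) \<le> B * (\<beta> j - \<beta> (Suc j))" if j: "real j > R" and \<nu>: "\<nu> \<in> K" for j \<nu>
  proof -
    define w where "w = (2 * real j + real r - R) / 2"
    have w: "w > 0" using j R by (simp add: w_def)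
    have re: "Re \<nu> \<ge> - R"
      using \<nu> abs_Re_le_cmod[of \<nu>] by (auto simp: K_def)
    have "2 * w + 1 \<le> Re (\<nu> + of_nat (2 * j + r) + 1)"
      using re by (simp add: w_def)
    also have "\<dots> \<le> norm (\<nu> + of_nat (2 * j + r) + 1)"
      by (rule complex_Re_le_cmod)
    finally have n: "2 * w + 1 \<le> norm (\<nu> + of_nat (2 * j + r) + 1)" .
    then have nz: "\<nu> + of_nat (2 * j + r) + 1 \<noteq> 0" using w by auto
    have "\<beta> (Suc j) = \<beta> j * (w / (w + 1 / 2))"
      using gamma_ratio_real_plus1[OF w] by (simp add: \<beta>_def w_def field_simps)
    \<comment> \<open>The step factor 1 / (2 w + 1) at the leftmost point is exactly the relative
      decrease of \<beta>, so the estimate of a difference is again a difference.\<close>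
    then have b: "\<beta> j / (2 * w + 1) = \<beta> j - \<beta> (Suc j)"
      using w by (simp add: field_simps)
    have "norm (c j \<nu> - c (Suc j) \<nu>) = norm (c j \<nu>) / norm (\<nu> + of_nat (2 * j + r) + 1)"
      using product_coeff_step[OF nz] by (simp add: c_def norm_divide)
    also have "\<dots> \<le> B * \<beta> j / (2 * w + 1)"
      by (intro frac_le c_le[OF j \<nu>] n order.trans[OF norm_ge_zero c_le[OF j \<nu>]]) (use w in auto)
    also have "\<dots> = B * (\<beta> j - \<beta> (Suc j))"
      by (simp flip: b)
    finally show ?thesis .
  qed
  have \<beta>_lim: "\<beta> \<longlonglongrightarrow> 0"
    unfolding \<beta>_def by (rule filterlim_compose[OF gamma_ratio_real_tendsto_0]) real_asymp
  have ev: "eventually (\<lambda>j. real j > R) sequentially"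
    by real_asymp
  have "uniform_limit K (\<lambda>J \<nu>. \<Sum>j<J. (\<Sum>i<Suc j. f i) * (c j \<nu> - c (Suc j) \<nu>))
     (\<lambda>\<nu>. \<Sum>j. (\<Sum>i<Suc j. f i) * (c j \<nu> - c (Suc j) \<nu>)) sequentially"
  proof (rule Weierstrass_m_test_ev)
    show "\<forall>\<^sub>F j in sequentially. \<forall>\<nu>\<in>K. norm ((\<Sum>i<Suc j. f i) * (c j \<nu> - c (Suc j) \<nu>)) \<le> C * (B * (\<beta> j - \<beta> (Suc j)))"
      using ev
    proof eventually_elim
      case (elim j)
      show ?case
        unfolding norm_mult by (intro ballI mult_mono C d_le elim C0) auto
    qed
    show "summable (\<lambda>j. C * (B * (\<beta> j - \<beta> (Suc j))))"
      by (intro summable_mult telescope_summable'[OF \<beta>_lim])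
  qed
  moreover have "uniform_limit K (\<lambda>J \<nu>. (\<Sum>i<J. f i) * c J \<nu>) (\<lambda>_. 0) sequentially"
  proof (rule uniform_limitI)
    fix e :: real assume e: "e > 0"
    have "(\<lambda>j. C * (B * \<beta> j)) \<longlonglongrightarrow> C * (B * 0)"
      by (intro tendsto_intros \<beta>_lim)
    then have "eventually (\<lambda>j. C * (B * \<beta> j) < e) sequentially"
      using e by (intro order_tendstoD(2)) auto
    then show "\<forall>\<^sub>F J in sequentially. \<forall>\<nu>\<in>K. dist ((\<Sum>i<J. f i) * c J \<nu>) 0 < e"
      using ev
    proof eventually_elim
      case (elim j)
      have "norm ((\<Sum>i<j. f i) * c j \<nu>) \<le> C * (B * \<beta> j)" if "\<nu> \<in> K" for \<nu>
        unfolding norm_mult by (intro mult_mono C c_le elim C0 that) auto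
      with elim(1) show ?case by fastforce
    qed
  qed
  ultimately have "uniform_limit K (\<lambda>J \<nu>. (\<Sum>j<J. (\<Sum>i<Suc j. f i) * (c j \<nu> - c (Suc j) \<nu>)) + (\<Sum>i<J. f i) * c J \<nu>)
     (\<lambda>\<nu>. (\<Sum>j. (\<Sum>i<Suc j. f i) * (c j \<nu> - c (Suc j) \<nu>)) + 0) sequentially"
    by (rule uniform_limit_add)
  then show ?thesis
    unfolding K_def c_def by (simp add: sum_by_parts[of f] del: sum.lessThan_Suc)
qed

lemma parity_sum_holomorphic:
  fixes f :: "nat \<Rightarrow> complex"
  assumes C: "\<And>J. norm (\<Sum>i<J. f i) \<le> C"
  obtains T where "T holomorphic_on UNIV" "\<And>\<nu>. (\<lambda>j. f j * product_coeff (2 * j + r) \<nu>) sums T \<nu>"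
proof -
  define T where "T = (\<lambda>\<nu>. \<Sum>j. (\<Sum>i<Suc j. f i) * (product_coeff (2 * j + r) \<nu> - product_coeff (2 * Suc j + r) \<nu>))"
  have ul: "uniform_limit (cball 0 R) (\<lambda>J \<nu>. \<Sum>j<J. f j * product_coeff (2 * j + r) \<nu>) T sequentially" for R
    unfolding T_def by (rule uniform_limit_parity_sum[OF C])
  show ?thesis
  proof
    show "T holomorphic_on UNIV"
    proof (rule holomorphic_uniform_sequence)
      show "(\<lambda>\<nu>. \<Sum>j<J. f j * product_coeff (2 * j + r) \<nu>) holomorphic_on UNIV" for J
        by (intro holomorphic_intros product_coeff_holomorphic)
      show "\<exists>d>0. cball x d \<subseteq> UNIV \<and> uniform_limit (cball x d) (\<lambda>J \<nu>. \<Sum>j<J. f j * product_coeff (2 * j + r) \<nu>) T sequentially" for x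
      proof (intro exI[of _ 1] conjI)
        have "cball x 1 \<subseteq> cball 0 (norm x + 1)"
          using cball_subset_cball_iff[of x 1 0 "norm x + 1"] by simp
        then show "uniform_limit (cball x 1) (\<lambda>J \<nu>. \<Sum>j<J. f j * product_coeff (2 * j + r) \<nu>) T sequentially"
          by (rule uniform_limit_on_subset[OF ul])
      qed auto
    qed auto
    show "(\<lambda>j. f j * product_coeff (2 * j + r) \<nu>) sums T \<nu>" for \<nu>
      unfolding sums_def by (rule tendsto_uniform_limitI[OF ul[of "norm \<nu>"]]) simp
  qed
qed

text \<open>Half the sum and half the difference of the plain and alternating partial sums are the
  sums over even and over odd indices. Both are therefore bounded by C, and each parity class can be
  handled on its own.\<close>

lemma product_coeff_sum_holomorphic:
  fixes f :: "nat \<Rightarrow> complex"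
  assumes 1: "\<And>n. norm (\<Sum>k<n. f k) \<le> C" and 2: "\<And>n. norm (\<Sum>k<n. (- 1) ^ k * f k) \<le> C"
  obtains T where "T holomorphic_on UNIV" "\<And>\<nu>. (\<lambda>n. f n * product_coeff n \<nu>) sums T \<nu>"
proof -
  have even: "2 * (\<Sum>j<J. f (2 * j)) = (\<Sum>k<2 * J. f k) + (\<Sum>k<2 * J. (- 1) ^ k * f k)" for J
    by (induction J) (auto simp: algebra_simps)
  have odd: "2 * (\<Sum>j<J. f (Suc (2 * j))) = (\<Sum>k<2 * J. f k) - (\<Sum>k<2 * J. (- 1) ^ k * f k)" for J
    by (induction J) (auto simp: algebra_simps)
  have "norm (2 * (\<Sum>j<J. f (2 * j))) \<le> C + C" "norm (2 * (\<Sum>j<J. f (Suc (2 * j)))) \<le> C + C" for J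
    unfolding even odd
    by (rule order.trans[OF norm_triangle_ineq add_mono[OF 1 2]])
       (rule order.trans[OF norm_triangle_ineq4 add_mono[OF 1 2]])
  then have b: "norm (\<Sum>j<J. f (2 * j)) \<le> C" "norm (\<Sum>j<J. f (Suc (2 * j))) \<le> C" for J
    by (simp_all add: norm_mult)
  from parity_sum_holomorphic[of _ _ 0, OF b(1)] obtain T0
    where T0: "T0 holomorphic_on UNIV" "\<And>\<nu>. (\<lambda>j. f (2 * j) * product_coeff (2 * j + 0) \<nu>) sums T0 \<nu>"
    by blast
  from parity_sum_holomorphic[of _ _ 1, OF b(2)] obtain T1
    where T1: "T1 holomorphic_on UNIV" "\<And>\<nu>. (\<lambda>j. f (Suc (2 * j)) * product_coeff (2 * j + 1) \<nu>) sums T1 \<nu>"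
    by blast
  show ?thesis
  proof
    show "(\<lambda>\<nu>. T1 \<nu> + T0 \<nu>) holomorphic_on UNIV"
      by (intro holomorphic_intros T0 T1)
    fix \<nu>
    let ?g = "\<lambda>n. f n * product_coeff n \<nu>"
    \<comment> \<open>Padded with zeros, the two parity series share one index and can be added
      termwise.\<close>
    have "(\<lambda>n. if even n then ?g n else 0) sums T0 \<nu>"
      using T0(2)[of \<nu>]
      by (subst sums_mono_reindex [symmetric, where g = "\<lambda>j. 2 * j"]) (auto simp: strict_mono_def elim!: evenE)
    moreover have "(\<lambda>n. if even n then 0 else ?g n) sums T1 \<nu>"
      using T1(2)[of \<nu>]
      by (subst sums_mono_reindex [symmetric, where g = "\<lambda>j. Suc (2 * j)"]) (auto simp: strict_mono_def elim!: oddE)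
    ultimately have "(\<lambda>n. (if even n then 0 else ?g n) + (if even n then ?g n else 0)) sums (T1 \<nu> + T0 \<nu>)"
      by (intro sums_add)
    also have "(\<lambda>n. (if even n then 0 else ?g n) + (if even n then ?g n else 0)) = ?g"
      by auto
    finally show "(\<lambda>n. f n * product_coeff n \<nu>) sums (T1 \<nu> + T0 \<nu>)" .
  qed
qed

section \<open>Entire dependence of the parabolic cylinder function\<close>

lemma norm_pochhammer_le:
  fixes \<nu> :: "'a::real_normed_field"
  assumes "norm \<nu> \<le> R"
  shows "norm (pochhammer \<nu> n) \<le> pochhammer R n"
  unfolding pochhammer_prod prod_norm [symmetric]
  by (intro prod_mono conjI norm_ge_zero order.trans[OF norm_triangle_ineq]) (use assms in auto)

lemma summable_kummer_real:
  fixes R m r :: real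
  assumes "R \<ge> 0" "m > 0" "r \<ge> 0"
  shows "summable (\<lambda>n. pochhammer R n / pochhammer m n * (r ^ n / fact n))"
proof -
  let ?f = "\<lambda>n. pochhammer R n / pochhammer m n * (r ^ n / fact n)"
  have "((\<lambda>n. (R + real n) / (m + real n) * (r / (real n + 1))) \<longlongrightarrow> 0) sequentially"
    by real_asymp
  then have "eventually (\<lambda>n. (R + real n) / (m + real n) * (r / (real n + 1)) < 1 / 2) sequentially"
    by (rule order_tendstoD) auto
  then obtain N where N: "(R + real n) / (m + real n) * (r / (real n + 1)) < 1 / 2" if "n \<ge> N" for n
    by (auto simp: eventually_sequentially)
  have pos: "?f n \<ge> 0" for n
    using assms by (intro mult_nonneg_nonneg divide_nonneg_nonneg) (auto simp: pochhammer_prod intro!: prod_nonneg)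
  show ?thesis
  proof (rule summable_ratio_test[of "1 / 2" N])
    fix n assume n: "n \<ge> N"
    have "?f (Suc n) = ((R + real n) / (m + real n) * (r / (real n + 1))) * ?f n"
      using assms by (simp add: pochhammer_rec' field_simps)
    also have "\<dots> \<le> 1 / 2 * ?f n"
      by (intro mult_right_mono pos less_imp_le[OF N[OF n]])
    finally show "norm (?f (Suc n)) \<le> 1 / 2 * norm (?f n)"
      using pos[of n] pos[of "Suc n"] by (simp only: real_norm_def abs_of_nonneg)
  qed auto
qed

definition kummer_term :: "complex \<Rightarrow> complex \<Rightarrow> complex \<Rightarrow> nat \<Rightarrow> complex" where
  "kummer_term \<nu> \<mu> z n = pochhammer \<nu> n / pochhammer \<mu> n * (z ^ n / fact n)"

text \<open>One real majorant serves both kinds of holomorphy, in the upper parameter and in the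
  argument. A positive lower parameter makes the modulus of its Pochhammer symbol exact.\<close>

lemma norm_kummer_term_le:
  assumes "norm \<nu> \<le> R" "norm z \<le> r" "m > 0"
  shows "norm (kummer_term \<nu> (of_real m) z n) \<le> pochhammer R n / pochhammer m n * (r ^ n / fact n)"
proof -
  have "norm (pochhammer (of_real m :: complex) n) = pochhammer m n"
    using assms by (simp add: pochhammer_of_real pochhammer_pos abs_of_pos)
  then show ?thesis
    unfolding kummer_term_def norm_mult norm_divide norm_power norm_fact
    using assms pochhammer_pos[of m n]
    by (auto intro!: mult_mono divide_right_mono norm_pochhammer_le power_mono divide_nonneg_nonneg
        simp: norm_power order.trans[OF norm_ge_zero norm_pochhammer_le])
qed

text \<open>The M-test on unit discs. The majorant is allowed to depend on the radius, as the Kummer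
  majorants do.\<close>

lemma holomorphic_suminf:
  fixes f :: "nat \<Rightarrow> complex \<Rightarrow> complex"
  assumes hol: "\<And>n. f n holomorphic_on UNIV"
    and M: "\<And>R. R \<ge> 0 \<Longrightarrow> summable (M R)"
    and le: "\<And>R n x. norm x \<le> R \<Longrightarrow> norm (f n x) \<le> M R n"
  shows "(\<lambda>x. \<Sum>n. f n x) holomorphic_on UNIV"
proof (rule holomorphic_uniform_sequence)
  show "(\<lambda>x. \<Sum>j<J. f j x) holomorphic_on UNIV" for J
    by (intro holomorphic_intros hol)
  show "\<exists>d>0. cball x d \<subseteq> UNIV \<and> uniform_limit (cball x d) (\<lambda>J x. \<Sum>j<J. f j x) (\<lambda>x. \<Sum>n. f n x) sequentially" for x
  proof (intro exI[of _ 1] conjI Weierstrass_m_test)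
    show "norm (f n y) \<le> M (norm x + 1) n" if "y \<in> cball x 1" for n y
    proof (rule le)
      show "norm y \<le> norm x + 1"
        using that norm_triangle_ineq2[of y x] by (simp add: dist_norm norm_minus_commute)
    qed
    show "summable (M (norm x + 1))" by (rule M) auto
  qed auto
qed auto

lemma kummer_holomorphic_fst:
  assumes "m > 0"
  shows "(\<lambda>\<nu>. kummer \<nu> (of_real m) z) holomorphic_on UNIV"
  unfolding kummer_def kummer_term_def [symmetric]
proof (rule holomorphic_suminf[where M = "\<lambda>R n. pochhammer R n / pochhammer m n * (norm z ^ n / fact n)"])
  show "(\<lambda>\<nu>. kummer_term \<nu> (of_real m) z n) holomorphic_on UNIV" for n
    unfolding kummer_term_def pochhammer_prod[of _ n] divide_inverse by (intro holomorphic_intros)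
qed (rule summable_kummer_real norm_kummer_term_le; simp add: assms)+

lemma kummer_holomorphic_arg:
  assumes "m > 0"
  shows "(\<lambda>z. kummer \<nu> (of_real m) z) holomorphic_on UNIV"
  unfolding kummer_def kummer_term_def [symmetric]
proof (rule holomorphic_suminf[where M = "\<lambda>r n. pochhammer (norm \<nu>) n / pochhammer m n * (r ^ n / fact n)"])
  show "(\<lambda>z. kummer_term \<nu> (of_real m) z n) holomorphic_on UNIV" for n
    unfolding kummer_term_def by (intro holomorphic_intros) auto
qed (rule summable_kummer_real norm_kummer_term_le; simp add: assms)+

lemma kummer_holomorphic_parameter [holomorphic_intros]:
  assumes "f holomorphic_on A"
  shows "(\<lambda>x. kummer (f x) (1 / 2) z) holomorphic_on A" "(\<lambda>x. kummer (f x) (3 / 2) z) holomorphic_on A"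
  using holomorphic_on_compose_gen[OF assms kummer_holomorphic_fst[of "1 / 2" z]]
    holomorphic_on_compose_gen[OF assms kummer_holomorphic_fst[of "3 / 2" z]]
  by (auto simp: o_def)

lemma kummer_holomorphic_argument [holomorphic_intros]:
  assumes "f holomorphic_on A"
  shows "(\<lambda>x. kummer \<nu> (1 / 2) (f x)) holomorphic_on A" "(\<lambda>x. kummer \<nu> (3 / 2) (f x)) holomorphic_on A"
  using holomorphic_on_compose_gen[OF assms kummer_holomorphic_arg[of "1 / 2" \<nu>]]
    holomorphic_on_compose_gen[OF assms kummer_holomorphic_arg[of "3 / 2" \<nu>]]
  by (auto simp: o_def)

lemma parabolic_cylinder_D_holomorphic_parameter:
  "(\<lambda>\<nu>. parabolic_cylinder_D (- \<nu>) z) holomorphic_on A"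
  unfolding parabolic_cylinder_D_def by (intro holomorphic_intros) auto

lemma parabolic_cylinder_D_holomorphic [holomorphic_intros]:
  assumes "f holomorphic_on A"
  shows "(\<lambda>z. parabolic_cylinder_D \<nu> (f z)) holomorphic_on A"
  unfolding parabolic_cylinder_D_def by (intro holomorphic_intros assms) auto

section \<open>Integral identities\<close>

text \<open>Change of variables for absolutely integrable functions is an equivalence: in the finite
  case it transports the value, in the infinite case the divergence. Callers therefore owe no
  integrability proof.\<close>

lemma nn_integral_substitution_inj:
  fixes g g' f :: "real \<Rightarrow> real"
  assumes S: "S \<in> sets borel" and T: "T \<in> sets borel" "g ` S = T"
    and der: "\<And>x. x \<in> S \<Longrightarrow> (g has_field_derivative g' x) (at x)"
    and inj: "inj_on g S"
    and nonneg: "\<And>x. x \<in> S \<Longrightarrow> g' x \<ge> 0" "\<And>x. x \<in> T \<Longrightarrow> f x \<ge> 0"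
    and [measurable]: "f \<in> borel_measurable borel" "g \<in> borel_measurable borel" "g' \<in> borel_measurable borel"
  shows "(\<integral>\<^sup>+x\<in>T. ennreal (f x) \<partial>lborel) = (\<integral>\<^sup>+x\<in>S. ennreal (g' x * f (g x)) \<partial>lborel)"
proof -
  note [measurable] = S T(1)
  have ind: "(\<integral>\<^sup>+x\<in>A. ennreal (h x) \<partial>lborel) = (\<integral>\<^sup>+x. ennreal (indicator A x * h x) \<partial>lborel)"
    for A and h :: "real \<Rightarrow> real"
    by (intro nn_integral_cong) (auto simp: indicator_def)
  have fin: "(\<integral>\<^sup>+x\<in>A. ennreal (h x) \<partial>lborel) = ennreal b"
    if "h absolutely_integrable_on A" "integral A h = b" "\<And>x. x \<in> A \<Longrightarrow> h x \<ge> 0"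
      "h \<in> borel_measurable borel" "A \<in> sets borel" for A and h :: "real \<Rightarrow> real" and b
  proof -
    have "(h has_integral b) A"
      using that(1,2) by (metis set_lebesgue_integral_eq_integral(1) has_integral_integral)
    then show ?thesis
      unfolding ind using that by (subst nn_integral_has_integral_lebesgue) auto
  qed
  have abs_int: "h absolutely_integrable_on A"
    if "(\<integral>\<^sup>+x\<in>A. ennreal (h x) \<partial>lborel) < \<infinity>" "\<And>x. x \<in> A \<Longrightarrow> h x \<ge> 0"
      "h \<in> borel_measurable borel" "A \<in> sets borel" for A and h :: "real \<Rightarrow> real"
  proof -
    note [measurable] = that(3,4)
    have "integrable lborel (\<lambda>x. indicator A x *\<^sub>R h x)"
    proof (rule integrableI_bounded)
      have "(\<integral>\<^sup>+x. ennreal (norm (indicator A x *\<^sub>R h x)) \<partial>lborel) = (\<integral>\<^sup>+x\<in>A. ennreal (h x) \<partial>lborel)"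
        using that(2) by (intro nn_integral_cong) (auto simp: indicator_def)
      with that(1) show "(\<integral>\<^sup>+x. ennreal (norm (indicator A x *\<^sub>R h x)) \<partial>lborel) < \<infinity>" by simp
    qed measurable
    then show ?thesis
      unfolding set_integrable_def using integrable_completion[of "\<lambda>x. indicator A x *\<^sub>R h x" lborel] that(3,4) by simp
  qed
  have cov: "((\<lambda>x. g' x * f (g x)) absolutely_integrable_on S \<and> integral S (\<lambda>x. g' x * f (g x)) = b) \<longleftrightarrow>
      (f absolutely_integrable_on T \<and> integral T f = b)" for b
  proof -
    have eq: "\<bar>g' x\<bar> * f (g x) = g' x * f (g x)" if "x \<in> S" for x
      using nonneg(1)[OF that] by simp
    have "(\<lambda>x. \<bar>g' x\<bar> * f (g x)) absolutely_integrable_on S \<longleftrightarrow> (\<lambda>x. g' x * f (g x)) absolutely_integrable_on S"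
      by (rule set_integrable_cong) (auto simp: eq)
    moreover have "integral S (\<lambda>x. \<bar>g' x\<bar> * f (g x)) = integral S (\<lambda>x. g' x * f (g x))"
      by (rule integral_cong) (auto simp: eq)
    ultimately show ?thesis
      using has_absolute_integral_change_of_variables_1'[of S g g' f b] S der inj T
      by (auto intro: has_field_derivative_at_within)
  qed
  have nn: "g' x * f (g x) \<ge> 0" if "x \<in> S" for x
    using nonneg that T by auto
  show ?thesis
  proof (cases "(\<integral>\<^sup>+x\<in>T. ennreal (f x) \<partial>lborel) < \<infinity>")
    case True
    then have "f absolutely_integrable_on T"
      by (rule abs_int) (use nonneg in auto)
    moreover from this and cov have "(\<lambda>x. g' x * f (g x)) absolutely_integrable_on S"
      "integral S (\<lambda>x. g' x * f (g x)) = integral T f" by auto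
    ultimately show ?thesis
      by (subst (1 2) fin[OF _ refl]) (use nonneg nn in auto)
  next
    case False
    have "\<not> (\<integral>\<^sup>+x\<in>S. ennreal (g' x * f (g x)) \<partial>lborel) < \<infinity>"
    proof
      assume "(\<integral>\<^sup>+x\<in>S. ennreal (g' x * f (g x)) \<partial>lborel) < \<infinity>"
      then have "(\<lambda>x. g' x * f (g x)) absolutely_integrable_on S"
        by (rule abs_int) (use nn in auto)
      with cov have "f absolutely_integrable_on T" by auto
      then show False
        using fin[where h = f and A = T, OF _ refl] nonneg False by auto
    qed
    with False show ?thesis by (metis infinity_ennreal_def top.not_eq_extremum)
  qed
qed

text \<open>For t = sqrt (y^2 + q) + y the companion q / t is sqrt (y^2 + q) - y, so y is half the
  difference of two numbers with product q. The same coordinate serves the product of two integrals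
  and the integral of exp (-a w - b / w).\<close>

lemma nn_integral_hyperbolic_substitution:
  fixes f :: "real \<Rightarrow> real"
  assumes q: "q > 0" and f: "\<And>t. t > 0 \<Longrightarrow> f t \<ge> 0" and [measurable]: "f \<in> borel_measurable borel"
  shows "(\<integral>\<^sup>+t\<in>{0<..}. ennreal (f t) \<partial>lborel) =
    (\<integral>\<^sup>+y. ennreal ((sqrt (y\<^sup>2 + q) + y) / sqrt (y\<^sup>2 + q) * f (sqrt (y\<^sup>2 + q) + y)) \<partial>lborel)"
proof -
  define g where "g = (\<lambda>y. sqrt (y\<^sup>2 + q) + y)"
  have pos: "y\<^sup>2 + q > 0" for y
    using q by (simp add: add_nonneg_pos)
  have gpos: "g y > 0" for y
  proof -
    have "\<bar>y\<bar> < sqrt (y\<^sup>2 + q)"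
      using q by (intro real_less_rsqrt) auto
    then show ?thesis by (auto simp: g_def)
  qed
  have inv: "(g y - q / g y) / 2 = y" for y
  proof -
    have "g y * (sqrt (y\<^sup>2 + q) - y) = q"
      using pos[of y] by (simp add: g_def algebra_simps power2_eq_square)
    then have "q / g y = sqrt (y\<^sup>2 + q) - y"
      using gpos[of y] by (simp add: field_simps)
    then show ?thesis by (simp add: g_def)
  qed
  have surj: "g ((t - q / t) / 2) = t" if "t > 0" for t
  proof -
    have "((t - q / t) / 2)\<^sup>2 + q = ((t + q / t) / 2)\<^sup>2"
      using that by (simp add: field_simps power2_eq_square)
    then have "sqrt (((t - q / t) / 2)\<^sup>2 + q) = (t + q / t) / 2"
      using that q by simp
    then show ?thesis using that by (simp add: g_def field_simps)
  qed
  have "(\<integral>\<^sup>+t\<in>{0<..}. ennreal (f t) \<partial>lborel) = (\<integral>\<^sup>+y\<in>UNIV. ennreal (g y / sqrt (y\<^sup>2 + q) * f (g y)) \<partial>lborel)"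
  proof (rule nn_integral_substitution_inj)
    show "g ` UNIV = {0<..}"
      using gpos surj by (auto simp: image_iff) metis
    show "inj g"
      by (metis injI inv)
    show "(g has_field_derivative g y / sqrt (y\<^sup>2 + q)) (at y)" for y
      unfolding g_def using pos[of y] by (auto intro!: derivative_eq_intros simp: field_simps)
    show "0 \<le> g x / sqrt (x\<^sup>2 + q)" for x
      using gpos[of x] pos[of x] by (intro divide_nonneg_nonneg) auto
  qed (use f in \<open>auto simp: g_def\<close>)
  then show ?thesis by (simp add: g_def)
qed

section \<open>Closed forms of Gamma, Gaussian and inverse Gaussian integrals\<close>

lemma nn_integral_Gamma_scaled:
  assumes s: "s > 0" and c: "c > (0::real)"
  shows "(\<integral>\<^sup>+t\<in>{0<..}. ennreal (t powr (s - 1) * exp (- c * t)) \<partial>lborel) = ennreal (Gamma s / c powr s)"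
proof -
  have "ennreal (Gamma s) = (\<integral>\<^sup>+t\<in>{0<..}. ennreal (t powr (s - 1) * exp (- t)) \<partial>lborel)"
    unfolding Gamma_conv_nn_integral_real[OF s]
    by (intro nn_integral_cong_AE AE_I[of _ _ "{0}"]) (auto simp: indicator_def exp_minus field_simps)
  also have "\<dots> = (\<integral>\<^sup>+t\<in>{0<..}. ennreal (c * ((c * t) powr (s - 1) * exp (- (c * t)))) \<partial>lborel)"
  proof (rule nn_integral_substitution_inj)
    show "(*) c ` {0<..} = {0<..}"
    proof safe
      fix x :: real assume "x > 0"
      then show "x \<in> (*) c ` {0<..}"
        using c by (intro image_eqI[of _ _ "x / c"]) auto
    qed (use c in auto)
    show "((*) c has_field_derivative c) (at x)" for x
      by (auto intro!: derivative_eq_intros)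
  qed (use c in \<open>auto intro: inj_onI\<close>)
  also have "\<dots> = (\<integral>\<^sup>+t. ennreal (c powr s) * (ennreal (t powr (s - 1) * exp (- c * t)) * indicator {0<..} t) \<partial>lborel)"
  proof (intro nn_integral_cong)
    fix t :: real
    show "ennreal (c * ((c * t) powr (s - 1) * exp (- (c * t)))) * indicator {0<..} t =
       ennreal (c powr s) * (ennreal (t powr (s - 1) * exp (- c * t)) * indicator {0<..} t)"
    proof (cases "t > 0")
      case True
      then have "c * ((c * t) powr (s - 1) * exp (- (c * t))) = c powr s * (t powr (s - 1) * exp (- c * t))"
        using c by (simp add: powr_mult powr_diff)
      then show ?thesis
        using True by (simp only: ennreal_mult' powr_ge_zero) simp
    qed auto
  qed
  also have "\<dots> = ennreal (c powr s) * (\<integral>\<^sup>+t\<in>{0<..}. ennreal (t powr (s - 1) * exp (- c * t)) \<partial>lborel)"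
    by (intro nn_integral_cmult) auto
  finally have "ennreal (1 / c powr s) * ennreal (Gamma s) = ennreal (1 / c powr s) * (ennreal (c powr s) * (\<integral>\<^sup>+t\<in>{0<..}. ennreal (t powr (s - 1) * exp (- c * t)) \<partial>lborel))"
    by simp
  then show ?thesis
    using c Gamma_real_pos[OF s] by (simp add: ennreal_mult [symmetric] mult.assoc [symmetric] del: ennreal_1) (simp add: ennreal_mult'' [symmetric])
qed

lemma nn_integral_Gaussian_moment:
  assumes m: "m > (0::real)"
  shows "(\<integral>\<^sup>+t\<in>{0<..}. ennreal (t powr (m - 1) * exp (- t\<^sup>2 / 2)) \<partial>lborel) = ennreal (2 powr (m / 2 - 1) * Gamma (m / 2))"
proof -
  let ?c = "2 powr (1 - m / 2) :: real"
  have "ennreal (Gamma (m / 2)) = (\<integral>\<^sup>+t\<in>{0<..}. ennreal (t powr (m / 2 - 1) * exp (- t)) \<partial>lborel)"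
    using nn_integral_Gamma_scaled[of "m / 2" 1] m by simp
  also have "\<dots> = (\<integral>\<^sup>+t\<in>{0<..}. ennreal (t * ((t\<^sup>2 / 2) powr (m / 2 - 1) * exp (- (t\<^sup>2 / 2)))) \<partial>lborel)"
  proof (rule nn_integral_substitution_inj)
    show "(\<lambda>t::real. t\<^sup>2 / 2) ` {0<..} = {0<..}"
    proof safe
      fix x :: real assume "x > 0"
      then show "x \<in> (\<lambda>t. t\<^sup>2 / 2) ` {0<..}"
        by (intro image_eqI[of _ _ "sqrt (2 * x)"]) auto
    qed auto
    show "((\<lambda>t. t\<^sup>2 / 2) has_field_derivative x) (at x)" for x :: real
      by (auto intro!: derivative_eq_intros)
    show "inj_on (\<lambda>t::real. t\<^sup>2 / 2) {0<..}"
      by (rule inj_onI) (auto simp: power2_eq_iff)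
  qed auto
  also have "\<dots> = (\<integral>\<^sup>+t. ennreal ?c * (ennreal (t powr (m - 1) * exp (- t\<^sup>2 / 2)) * indicator {0<..} t) \<partial>lborel)"
  proof (intro nn_integral_cong)
    fix t :: real
    have "t * ((t\<^sup>2 / 2) powr (m / 2 - 1) * exp (- (t\<^sup>2 / 2))) = ?c * (t powr (m - 1) * exp (- t\<^sup>2 / 2))" if "t > 0"
    proof -
      have "t * (t\<^sup>2 / 2) powr (m / 2 - 1) = t powr 1 * (t powr 2) powr (m / 2 - 1) / 2 powr (m / 2 - 1)"
        using that by (simp add: powr_divide powr_numeral)
      also have "\<dots> = t powr (1 + 2 * (m / 2 - 1)) / 2 powr (m / 2 - 1)"
        by (simp only: powr_powr powr_add)
      also have "1 + 2 * (m / 2 - 1) = m - 1" by simp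
      also have "t powr (m - 1) / 2 powr (m / 2 - 1) = ?c * t powr (m - 1)"
        using powr_minus_divide[of 2 "m / 2 - 1"] by simp
      finally show ?thesis by simp
    qed
    then show "ennreal (t * ((t\<^sup>2 / 2) powr (m / 2 - 1) * exp (- (t\<^sup>2 / 2)))) * indicator {0<..} t =
       ennreal ?c * (ennreal (t powr (m - 1) * exp (- t\<^sup>2 / 2)) * indicator {0<..} t)"
      by (cases "t > 0") (simp_all only: ennreal_mult' powr_ge_zero, auto)
  qed
  also have "\<dots> = ennreal ?c * (\<integral>\<^sup>+t\<in>{0<..}. ennreal (t powr (m - 1) * exp (- t\<^sup>2 / 2)) \<partial>lborel)"
    by (intro nn_integral_cmult) auto
  finally have "ennreal (2 powr (m / 2 - 1)) * ennreal (Gamma (m / 2)) = ennreal (2 powr (m / 2 - 1)) * ennreal ?c * (\<integral>\<^sup>+t\<in>{0<..}. ennreal (t powr (m - 1) * exp (- t\<^sup>2 / 2)) \<partial>lborel)"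
    by (simp add: mult.assoc)
  also have "ennreal (2 powr (m / 2 - 1)) * ennreal ?c = 1"
    by (simp add: ennreal_mult [symmetric] powr_add [symmetric])
  finally show ?thesis
    using Gamma_real_pos[of "m / 2"] m by (simp add: ennreal_mult [symmetric])
qed

lemma nn_integral_Gaussian_linear:
  assumes c: "c > (0::real)"
  shows "(\<integral>\<^sup>+y. ennreal (exp (- c * y\<^sup>2 - 2 * z * y)) \<partial>lborel) = ennreal (sqrt (pi / c) * exp (z\<^sup>2 / c))"
proof -
  \<comment> \<open>Completing the square yields a multiple of the normal density with mean -z / c
    and variance 1 / (2 c).\<close>
  define \<sigma> where "\<sigma> = 1 / sqrt (2 * c)"
  have \<sigma>: "\<sigma> > 0" "\<sigma>\<^sup>2 = 1 / (2 * c)" using c by (simp_all add: \<sigma>_def power_divide)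
  have "exp (- c * y\<^sup>2 - 2 * z * y) = sqrt (pi / c) * exp (z\<^sup>2 / c) * normal_density (- z / c) \<sigma> y" for y
  proof -
    have "- (y - - z / c)\<^sup>2 / (2 * \<sigma>\<^sup>2) = - (c * y\<^sup>2 + 2 * z * y + z\<^sup>2 / c)"
      using c unfolding \<sigma>(2) by (simp add: field_simps power2_eq_square)
    moreover have "2 * pi * \<sigma>\<^sup>2 = pi / c" by (simp add: \<sigma>)
    ultimately have "normal_density (- z / c) \<sigma> y = 1 / sqrt (pi / c) * exp (- (c * y\<^sup>2 + 2 * z * y + z\<^sup>2 / c))"
      by (simp only: normal_density_def)
    moreover have "exp (- c * y\<^sup>2 - 2 * z * y) = exp (z\<^sup>2 / c) * exp (- (c * y\<^sup>2 + 2 * z * y + z\<^sup>2 / c))"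
      by (simp add: exp_add [symmetric])
    ultimately show ?thesis using c by simp
  qed
  then have "(\<integral>\<^sup>+y. ennreal (exp (- c * y\<^sup>2 - 2 * z * y)) \<partial>lborel) =
     (\<integral>\<^sup>+y. ennreal (sqrt (pi / c) * exp (z\<^sup>2 / c)) * ennreal (normal_density (- z / c) \<sigma> y) \<partial>lborel)"
    using c by (simp add: ennreal_mult normal_density_nonneg)
  also have "\<dots> = ennreal (sqrt (pi / c) * exp (z\<^sup>2 / c)) * (\<integral>\<^sup>+y. ennreal (normal_density (- z / c) \<sigma> y) \<partial>lborel)"
    by (intro nn_integral_cmult) auto
  also have "(\<integral>\<^sup>+y. ennreal (normal_density (- z / c) \<sigma> y) \<partial>lborel) = ennreal 1"
    using \<sigma> by (subst nn_integral_eq_integral) auto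
  finally show ?thesis by simp
qed

text \<open>The scaling w = t^2 / (4 a) makes the exponent symmetric in t and q / t for q = 4 sqrt
  (a b). In the hyperbolic coordinate the exponent is -y^2 - q / 2, and the Jacobian factor is 1
  plus an odd function of y, so a Gaussian integral remains.\<close>

lemma nn_integral_exp_neg_linear_neg_inverse:
  assumes a: "a > (0::real)" and b: "b \<ge> 0"
  shows "(\<integral>\<^sup>+w\<in>{0<..}. ennreal (exp (- a * w - b / w) / sqrt w) \<partial>lborel) = ennreal (sqrt (pi / a) * exp (- 2 * sqrt (a * b)))"
\<comment> \<open>The hyperbolic substitution needs q > 0. The case b = 0 is a Gamma integral at
  1/2; it is the one used for J(z) J(-z).\<close>
proof (cases "b = 0")
  case True
  have "(\<integral>\<^sup>+w\<in>{0<..}. ennreal (exp (- a * w) / sqrt w) \<partial>lborel) = (\<integral>\<^sup>+w\<in>{0<..}. ennreal (w powr (1 / 2 - 1) * exp (- a * w)) \<partial>lborel)"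
    by (intro nn_integral_cong) (auto simp: indicator_def powr_minus powr_half_sqrt field_simps)
  also have "\<dots> = ennreal (sqrt pi / sqrt a)"
    using a by (subst nn_integral_Gamma_scaled) (auto simp: Gamma_one_half_real powr_half_sqrt)
  finally show ?thesis
    using True by (simp add: real_sqrt_divide)
next
  case False
  with b have b: "b > 0" by simp
  define \<alpha> where "\<alpha> = sqrt a"
  define q where "q = 4 * sqrt (a * b)"
  have \<alpha>: "\<alpha> > 0" "\<alpha>\<^sup>2 = a" and q: "q > 0" "q\<^sup>2 = 16 * a * b"
    using a b by (auto simp: \<alpha>_def q_def power_mult_distrib)
  have "(\<integral>\<^sup>+w\<in>{0<..}. ennreal (exp (- a * w - b / w) / sqrt w) \<partial>lborel) =
     (\<integral>\<^sup>+t\<in>{0<..}. ennreal (t / (2 * a) * (exp (- a * (t\<^sup>2 / (4 * a)) - b / (t\<^sup>2 / (4 * a))) / sqrt (t\<^sup>2 / (4 * a)))) \<partial>lborel)"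
  proof (rule nn_integral_substitution_inj)
    show "(\<lambda>t::real. t\<^sup>2 / (4 * a)) ` {0<..} = {0<..}"
    proof safe
      fix x :: real assume "x > 0"
      then show "x \<in> (\<lambda>t. t\<^sup>2 / (4 * a)) ` {0<..}"
        using a by (intro image_eqI[of _ _ "sqrt (4 * a * x)"]) auto
    qed (use a in auto)
    show "((\<lambda>t. t\<^sup>2 / (4 * a)) has_field_derivative (x / (2 * a))) (at x)" for x :: real
      using a by (auto intro!: derivative_eq_intros simp: field_simps)
    show "inj_on (\<lambda>t::real. t\<^sup>2 / (4 * a)) {0<..}"
      using a by (intro inj_onI) (auto simp: power2_eq_iff)
  qed (use a in auto)
  also have "\<dots> = (\<integral>\<^sup>+t\<in>{0<..}. ennreal (exp (- (t\<^sup>2 + q\<^sup>2 / t\<^sup>2) / 4) / \<alpha>) \<partial>lborel)"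
  proof (intro nn_integral_cong)
    fix t :: real
    have "t / (2 * a) * (exp (- a * (t\<^sup>2 / (4 * a)) - b / (t\<^sup>2 / (4 * a))) / sqrt (t\<^sup>2 / (4 * a))) = exp (- (t\<^sup>2 + q\<^sup>2 / t\<^sup>2) / 4) / \<alpha>" if "t > 0"
    proof -
      have "sqrt (t\<^sup>2 / (4 * a)) = t / (2 * \<alpha>)"
        using that a by (simp add: real_sqrt_divide real_sqrt_mult \<alpha>_def)
      moreover have "- a * (t\<^sup>2 / (4 * a)) - b / (t\<^sup>2 / (4 * a)) = - (t\<^sup>2 + q\<^sup>2 / t\<^sup>2) / 4"
        using that a by (simp add: q field_simps)
      moreover have "t / (2 * a) / (t / (2 * \<alpha>)) = 1 / \<alpha>"
        using that \<alpha> a by (simp add: field_simps power2_eq_square)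
      moreover have "t / (2 * a) * (X / s) = t / (2 * a) / s * X" for X s :: real
        by simp
      ultimately show ?thesis
        by (simp only:) simp
    qed
    then show "ennreal (t / (2 * a) * (exp (- a * (t\<^sup>2 / (4 * a)) - b / (t\<^sup>2 / (4 * a))) / sqrt (t\<^sup>2 / (4 * a)))) * indicator {0<..} t
       = ennreal (exp (- (t\<^sup>2 + q\<^sup>2 / t\<^sup>2) / 4) / \<alpha>) * indicator {0<..} t"
      by (auto simp: indicator_def)
  qed
  also have "\<dots> = (\<integral>\<^sup>+y. ennreal ((sqrt (y\<^sup>2 + q) + y) / sqrt (y\<^sup>2 + q) *
      (exp (- ((sqrt (y\<^sup>2 + q) + y)\<^sup>2 + q\<^sup>2 / (sqrt (y\<^sup>2 + q) + y)\<^sup>2) / 4) / \<alpha>)) \<partial>lborel)"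
    by (rule nn_integral_hyperbolic_substitution) (use q \<alpha> in auto)
  also have "\<dots> = (\<integral>\<^sup>+y. ennreal (exp (- q / 2) / \<alpha> * ((1 + y / sqrt (y\<^sup>2 + q)) * exp (- y\<^sup>2))) \<partial>lborel)"
  proof (intro nn_integral_cong arg_cong[where f = ennreal])
    fix y :: real
    define R where "R = sqrt (y\<^sup>2 + q)"
    have R: "R > 0" "R\<^sup>2 = y\<^sup>2 + q" "R > \<bar>y\<bar>"
      using q by (auto simp: R_def add_nonneg_pos intro!: real_less_rsqrt)
    have "(R + y) * (R - y) = q" using R by (simp add: algebra_simps power2_eq_square)
    then have "q / (R + y) = R - y"
      using R by (simp add: field_simps)
    then have "q\<^sup>2 / (R + y)\<^sup>2 = (R - y)\<^sup>2" by (metis power_divide)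
    then have e: "(R + y)\<^sup>2 + q\<^sup>2 / (R + y)\<^sup>2 = 4 * y\<^sup>2 + 2 * q"
      using R by (simp add: power2_eq_square algebra_simps)
    have "- (4 * y\<^sup>2 + 2 * q) / 4 = - q / 2 + - y\<^sup>2" by (simp add: field_simps)
    then show "(sqrt (y\<^sup>2 + q) + y) / sqrt (y\<^sup>2 + q) * (exp (- ((sqrt (y\<^sup>2 + q) + y)\<^sup>2 + q\<^sup>2 / (sqrt (y\<^sup>2 + q) + y)\<^sup>2) / 4) / \<alpha>) =
       exp (- q / 2) / \<alpha> * ((1 + y / sqrt (y\<^sup>2 + q)) * exp (- y\<^sup>2))"
      unfolding R_def [symmetric] e using R by (simp only: exp_add) (simp add: field_simps)
  qed
  also have "\<dots> = ennreal (exp (- q / 2) / \<alpha>) * (\<integral>\<^sup>+y. ennreal ((1 + y / sqrt (y\<^sup>2 + q)) * exp (- y\<^sup>2)) \<partial>lborel)"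
  proof -
    have K: "0 \<le> exp (- q / 2) / \<alpha>" using \<alpha> by simp
    show ?thesis
      unfolding ennreal_mult'[OF K] by (rule nn_integral_cmult) simp
  qed
  also have "(\<integral>\<^sup>+y. ennreal ((1 + y / sqrt (y\<^sup>2 + q)) * exp (- y\<^sup>2)) \<partial>lborel) = ennreal (sqrt pi)"
  proof -
    let ?I = "\<integral>\<^sup>+y. ennreal ((1 + y / sqrt (y\<^sup>2 + q)) * exp (- y\<^sup>2)) \<partial>lborel"
    have le: "\<bar>y / sqrt (y\<^sup>2 + q)\<bar> \<le> 1" for y
      using q by (auto simp: divide_le_eq_1 abs_divide intro!: real_le_rsqrt add_nonneg_pos)
    \<comment> \<open>Reflection of y. Adding the two copies removes the odd part without any
      subtraction in \<open>ennreal\<close>.\<close>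
    have I: "?I = (\<integral>\<^sup>+y. ennreal ((1 - y / sqrt (y\<^sup>2 + q)) * exp (- y\<^sup>2)) \<partial>lborel)"
      by (subst nn_integral_real_affine[where c = "-1" and t = 0]) auto
    have "?I + ?I = (\<integral>\<^sup>+y. ennreal ((1 + y / sqrt (y\<^sup>2 + q)) * exp (- y\<^sup>2)) + ennreal ((1 - y / sqrt (y\<^sup>2 + q)) * exp (- y\<^sup>2)) \<partial>lborel)"
      by (subst (2) I) (subst nn_integral_add, auto)
    also have "\<dots> = (\<integral>\<^sup>+y. 2 * ennreal (exp (- 1 * y\<^sup>2 - 2 * 0 * y)) \<partial>lborel)"
    proof (intro nn_integral_cong)
      fix y :: real
      show "ennreal ((1 + y / sqrt (y\<^sup>2 + q)) * exp (- y\<^sup>2)) + ennreal ((1 - y / sqrt (y\<^sup>2 + q)) * exp (- y\<^sup>2)) = 2 * ennreal (exp (- 1 * y\<^sup>2 - 2 * 0 * y))"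
      proof -
        define r where "r = y / sqrt (y\<^sup>2 + q)"
        have r: "0 \<le> 1 + r" "0 \<le> 1 - r" using le[of y] unfolding r_def [symmetric] by linarith+
        have "ennreal ((1 + r) * exp (- y\<^sup>2)) + ennreal ((1 - r) * exp (- y\<^sup>2)) = ennreal ((1 + r) * exp (- y\<^sup>2) + (1 - r) * exp (- y\<^sup>2))"
          using r by (intro ennreal_plus [symmetric] mult_nonneg_nonneg) auto
        also have "(1 + r) * exp (- y\<^sup>2) + (1 - r) * exp (- y\<^sup>2) = 2 * exp (- 1 * y\<^sup>2 - 2 * 0 * y)"
          by (simp add: algebra_simps)
        also have "ennreal \<dots> = 2 * ennreal (exp (- 1 * y\<^sup>2 - 2 * 0 * y))"
          by (subst ennreal_mult') auto
        finally show ?thesis unfolding r_def .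
      qed
    qed
    also have "\<dots> = 2 * ennreal (sqrt pi)"
      by (subst nn_integral_cmult) (simp_all only: nn_integral_Gaussian_linear[of 1 0], auto)
    finally have "2 * ?I = 2 * ennreal (sqrt pi)" by (simp add: mult_2)
    then show ?thesis
      by (simp add: ennreal_mult_cancel_left)
  qed
  also have "ennreal (exp (- q / 2) / \<alpha>) * ennreal (sqrt pi) = ennreal (sqrt (pi / a) * exp (- 2 * sqrt (a * b)))"
    using \<alpha> by (simp add: ennreal_mult' [symmetric] \<alpha>_def q_def real_sqrt_divide mult_ac)
  finally show ?thesis .
qed

section \<open>Products of the integral representation\<close>

definition cylinder_integral :: "real \<Rightarrow> real \<Rightarrow> ennreal" where
  "cylinder_integral \<nu> z = (\<integral>\<^sup>+t\<in>{0<..}. ennreal (t powr (\<nu> - 1) * exp (- t\<^sup>2 / 2 - z * t)) \<partial>lborel)"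

lemma nn_integral_reciprocal_substitution:
  fixes f :: "real \<Rightarrow> real"
  assumes t: "t > 0" and f: "\<And>s. s > 0 \<Longrightarrow> f s \<ge> 0" and [measurable]: "f \<in> borel_measurable borel"
  shows "(\<integral>\<^sup>+s\<in>{0<..}. ennreal (f s) \<partial>lborel) = (\<integral>\<^sup>+q\<in>{0<..}. ennreal (1 / t * f (q / t)) \<partial>lborel)"
proof (rule nn_integral_substitution_inj)
  show "(\<lambda>q. q / t) ` {0<..} = {0<..}"
  proof safe
    fix x :: real assume "x > 0"
    then show "x \<in> (\<lambda>q. q / t) ` {0<..}"
      using t by (intro image_eqI[of _ _ "x * t"]) auto
  qed (use t in auto)
  show "((\<lambda>q. q / t) has_field_derivative 1 / t) (at x)" for x
    using t by (auto intro!: derivative_eq_intros)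
qed (use t f in \<open>auto intro: inj_onI\<close>)

text \<open>Substitute s = q / t at fixed t, exchange, then take the hyperbolic coordinate at fixed
  q. The factor 1 / t cancels the numerator of the second Jacobian, and (t^2 + s^2) / 2 becomes 2
  y^2 + q.\<close>

lemma cylinder_integral_product:
  "cylinder_integral \<nu> z * cylinder_integral \<nu> z' =
     (\<integral>\<^sup>+q\<in>{0<..}. (\<integral>\<^sup>+y. ennreal (q powr (\<nu> - 1) * exp (- q) *
        (exp (- 2 * y\<^sup>2 - z * (sqrt (y\<^sup>2 + q) + y) - z' * (sqrt (y\<^sup>2 + q) - y)) / sqrt (y\<^sup>2 + q))) \<partial>lborel) \<partial>lborel)"
proof -
  define f where "f = (\<lambda>z t::real. t powr (\<nu> - 1) * exp (- t\<^sup>2 / 2 - z * t))"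
  have f0: "f z t \<ge> 0" for z t by (simp add: f_def)
  have [measurable]: "f z \<in> borel_measurable borel" for z by (simp add: f_def)
  have [measurable]: "(\<lambda>x. f z (g x)) \<in> borel_measurable M" if "g \<in> borel_measurable M" for g z and M :: "'c measure"
    by (rule measurable_compose[OF that]) simp
  have "cylinder_integral \<nu> z * cylinder_integral \<nu> z' =
      (\<integral>\<^sup>+t. ennreal (f z t) * indicator {0<..} t * (\<integral>\<^sup>+s\<in>{0<..}. ennreal (f z' s) \<partial>lborel) \<partial>lborel)"
    unfolding cylinder_integral_def f_def by (subst nn_integral_multc) auto
  also have "\<dots> = (\<integral>\<^sup>+t. (\<integral>\<^sup>+q. ennreal (f z t * (1 / t * f z' (q / t))) * indicator {0<..} t * indicator {0<..} q \<partial>lborel) \<partial>lborel)"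
  proof (intro nn_integral_cong)
    fix t :: real
    show "ennreal (f z t) * indicator {0<..} t * (\<integral>\<^sup>+s\<in>{0<..}. ennreal (f z' s) \<partial>lborel) =
      (\<integral>\<^sup>+q. ennreal (f z t * (1 / t * f z' (q / t))) * indicator {0<..} t * indicator {0<..} q \<partial>lborel)"
    proof (cases "t > 0")
      case True
      then have "(\<integral>\<^sup>+s\<in>{0<..}. ennreal (f z' s) \<partial>lborel) = (\<integral>\<^sup>+q\<in>{0<..}. ennreal (1 / t * f z' (q / t)) \<partial>lborel)"
        by (intro nn_integral_reciprocal_substitution) (auto simp: f0)
      then have "ennreal (f z t) * indicator {0<..} t * (\<integral>\<^sup>+s\<in>{0<..}. ennreal (f z' s) \<partial>lborel) =
          ennreal (f z t) * (\<integral>\<^sup>+q\<in>{0<..}. ennreal (1 / t * f z' (q / t)) \<partial>lborel)"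
        using True by (simp only:) simp
      also have "\<dots> = (\<integral>\<^sup>+q. ennreal (f z t) * (ennreal (1 / t * f z' (q / t)) * indicator {0<..} q) \<partial>lborel)"
        by (rule nn_integral_cmult [symmetric]) measurable
      also have "\<dots> = (\<integral>\<^sup>+q. ennreal (f z t * (1 / t * f z' (q / t))) * indicator {0<..} t * indicator {0<..} q \<partial>lborel)"
        unfolding ennreal_mult'[OF f0] using True by (simp add: mult.assoc)
      finally show ?thesis .
    qed auto
  qed
  also have "\<dots> = (\<integral>\<^sup>+q. (\<integral>\<^sup>+t. ennreal (f z t * (1 / t * f z' (q / t))) * indicator {0<..} t * indicator {0<..} q \<partial>lborel) \<partial>lborel)"
    by (rule lborel_pair.Fubini') measurable
  also have "\<dots> = (\<integral>\<^sup>+q\<in>{0<..}. (\<integral>\<^sup>+y. ennreal (q powr (\<nu> - 1) * exp (- q) *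
        (exp (- 2 * y\<^sup>2 - z * (sqrt (y\<^sup>2 + q) + y) - z' * (sqrt (y\<^sup>2 + q) - y)) / sqrt (y\<^sup>2 + q))) \<partial>lborel) \<partial>lborel)"
  proof (intro nn_integral_cong)
    fix q :: real
    show "(\<integral>\<^sup>+t. ennreal (f z t * (1 / t * f z' (q / t))) * indicator {0<..} t * indicator {0<..} q \<partial>lborel) =
      (\<integral>\<^sup>+y. ennreal (q powr (\<nu> - 1) * exp (- q) *
        (exp (- 2 * y\<^sup>2 - z * (sqrt (y\<^sup>2 + q) + y) - z' * (sqrt (y\<^sup>2 + q) - y)) / sqrt (y\<^sup>2 + q))) \<partial>lborel) * indicator {0<..} q"
    proof (cases "q > 0")
      case q: True
      have "(\<integral>\<^sup>+t\<in>{0<..}. ennreal (f z t * (1 / t * f z' (q / t))) \<partial>lborel) =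
         (\<integral>\<^sup>+y. ennreal ((sqrt (y\<^sup>2 + q) + y) / sqrt (y\<^sup>2 + q) *
            (f z (sqrt (y\<^sup>2 + q) + y) * (1 / (sqrt (y\<^sup>2 + q) + y) * f z' (q / (sqrt (y\<^sup>2 + q) + y))))) \<partial>lborel)"
        by (rule nn_integral_hyperbolic_substitution) (use q f0 in auto)
      also have "\<dots> = (\<integral>\<^sup>+y. ennreal (q powr (\<nu> - 1) * exp (- q) *
        (exp (- 2 * y\<^sup>2 - z * (sqrt (y\<^sup>2 + q) + y) - z' * (sqrt (y\<^sup>2 + q) - y)) / sqrt (y\<^sup>2 + q))) \<partial>lborel)"
      proof (intro nn_integral_cong arg_cong[where f = ennreal])
        fix y :: real
        define R where "R = sqrt (y\<^sup>2 + q)"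
        have R: "R > 0" "R\<^sup>2 = y\<^sup>2 + q" "R > \<bar>y\<bar>"
          using q by (auto simp: R_def add_nonneg_pos intro!: real_less_rsqrt)
        have prod: "(R + y) * (R - y) = q" using R by (simp add: algebra_simps power2_eq_square)
        then have quot: "q / (R + y) = R - y"
          using R by (simp add: field_simps)
        have "(R + y) powr (\<nu> - 1) * (R - y) powr (\<nu> - 1) = q powr (\<nu> - 1)"
          using R by (subst powr_mult [symmetric]) (auto simp: prod)
        moreover have "exp (- (R + y)\<^sup>2 / 2 - z * (R + y)) * exp (- (R - y)\<^sup>2 / 2 - z' * (R - y)) =
            exp (- q) * exp (- 2 * y\<^sup>2 - z * (R + y) - z' * (R - y))"
        proof -
          have "- (R + y)\<^sup>2 / 2 - (R - y)\<^sup>2 / 2 = - q - 2 * y\<^sup>2"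
            using R(2) by (simp add: power2_sum power2_diff field_simps)
          then show ?thesis by (simp add: exp_add [symmetric])
        qed
        moreover have "(R + y) / R * (f z (R + y) * (1 / (R + y) * f z' (R - y))) =
           ((R + y) powr (\<nu> - 1) * (R - y) powr (\<nu> - 1)) * (exp (- (R + y)\<^sup>2 / 2 - z * (R + y)) * exp (- (R - y)\<^sup>2 / 2 - z' * (R - y))) / R"
        proof -
          have "R + y \<noteq> 0" using R by auto
          then show ?thesis by (simp add: f_def)
        qed
        ultimately show "(sqrt (y\<^sup>2 + q) + y) / sqrt (y\<^sup>2 + q) *
            (f z (sqrt (y\<^sup>2 + q) + y) * (1 / (sqrt (y\<^sup>2 + q) + y) * f z' (q / (sqrt (y\<^sup>2 + q) + y)))) =
            q powr (\<nu> - 1) * exp (- q) * (exp (- 2 * y\<^sup>2 - z * (sqrt (y\<^sup>2 + q) + y) - z' * (sqrt (y\<^sup>2 + q) - y)) / sqrt (y\<^sup>2 + q))"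
          unfolding R_def [symmetric] quot by (simp only:) simp
      qed
      finally show ?thesis using q by simp
    qed auto
  qed
  finally show ?thesis .
qed

definition cylinder_weight :: "real \<Rightarrow> real \<Rightarrow> real" where
  "cylinder_weight \<nu> w = (1 + w) powr (- \<nu>) / sqrt (w * (2 + w))"

text \<open>Common source of both product formulas: z = 0 with b the squared argument gives the
  square, b = 0 the mixed product. Once the w-integral is inserted, the integrand factors into
  functions of q and of y for each w, so w is moved outermost.\<close>

lemma nn_integral_cylinder_kernel:
  assumes \<nu>: "\<nu> > 0" and b: "b \<ge> 0"
  shows "(\<integral>\<^sup>+q\<in>{0<..}. (\<integral>\<^sup>+y. ennreal (q powr (\<nu> - 1) * exp (- q) *
        (exp (- 2 * y\<^sup>2 - 2 * z * y - 2 * sqrt b * sqrt (y\<^sup>2 + q)) / sqrt (y\<^sup>2 + q))) \<partial>lborel) \<partial>lborel) =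
      ennreal (Gamma \<nu>) * (\<integral>\<^sup>+w\<in>{0<..}. ennreal (cylinder_weight \<nu> w * exp (z\<^sup>2 / (2 + w) - b / w)) \<partial>lborel)"
proof -
  \<comment> \<open>\<open>A\<close> is the Gamma integrand in q, \<open>B\<close> the Gaussian in
    y, \<open>C\<close> the remaining function of w. The factor 1 / sqrt pi in \<open>C\<close>
    normalises the inserted w-integral.\<close>
  define A where "A = (\<lambda>w q::real. q powr (\<nu> - 1) * exp (- (1 + w) * q))"
  define B where "B = (\<lambda>w y::real. exp (- (2 + w) * y\<^sup>2 - 2 * z * y))"
  define C where "C = (\<lambda>w::real. exp (- b / w) / (sqrt pi * sqrt w))"
  have nonneg: "A w q \<ge> 0" "B w y \<ge> 0" "w > 0 \<Longrightarrow> C w \<ge> 0" for w q y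
    by (simp_all add: A_def B_def C_def)
  let ?F = "\<lambda>q y w. ennreal (A w q * B w y * C w) * indicator {0<..} q * indicator {0<..} w"
  have [measurable]: "(\<lambda>x. A (g x) (h x)) \<in> borel_measurable M" if [measurable]: "g \<in> borel_measurable M" "h \<in> borel_measurable M"
    for g h and M :: "'c measure"
    unfolding A_def by measurable
  have [measurable]: "(\<lambda>x. B (g x) (h x)) \<in> borel_measurable M" if [measurable]: "g \<in> borel_measurable M" "h \<in> borel_measurable M"
    for g h and M :: "'c measure"
    unfolding B_def by measurable
  have [measurable]: "(\<lambda>x. C (g x)) \<in> borel_measurable M" if [measurable]: "g \<in> borel_measurable M"
    for g and M :: "'c measure"
    unfolding C_def by measurable
  have "(\<integral>\<^sup>+q\<in>{0<..}. (\<integral>\<^sup>+y. ennreal (q powr (\<nu> - 1) * exp (- q) *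
        (exp (- 2 * y\<^sup>2 - 2 * z * y - 2 * sqrt b * sqrt (y\<^sup>2 + q)) / sqrt (y\<^sup>2 + q))) \<partial>lborel) \<partial>lborel) =
      (\<integral>\<^sup>+q. (\<integral>\<^sup>+y. (\<integral>\<^sup>+w. ?F q y w \<partial>lborel) \<partial>lborel) \<partial>lborel)"
  proof (intro nn_integral_cong)
    fix q :: real
    show "(\<integral>\<^sup>+y. ennreal (q powr (\<nu> - 1) * exp (- q) *
        (exp (- 2 * y\<^sup>2 - 2 * z * y - 2 * sqrt b * sqrt (y\<^sup>2 + q)) / sqrt (y\<^sup>2 + q))) \<partial>lborel) * indicator {0<..} q =
       (\<integral>\<^sup>+y. (\<integral>\<^sup>+w. ?F q y w \<partial>lborel) \<partial>lborel)"
    proof (cases "q > 0")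
      case q: True
      have "ennreal (q powr (\<nu> - 1) * exp (- q) *
        (exp (- 2 * y\<^sup>2 - 2 * z * y - 2 * sqrt b * sqrt (y\<^sup>2 + q)) / sqrt (y\<^sup>2 + q))) = (\<integral>\<^sup>+w. ?F q y w \<partial>lborel)" for y
      proof -
        define K where "K = q powr (\<nu> - 1) * exp (- q) * exp (- 2 * y\<^sup>2 - 2 * z * y) / sqrt pi"
        have K: "K \<ge> 0" by (simp add: K_def)
        have a: "y\<^sup>2 + q > 0" using q by (simp add: add_nonneg_pos)
        have "(\<integral>\<^sup>+w. ?F q y w \<partial>lborel) = (\<integral>\<^sup>+w. ennreal K * (ennreal (exp (- (y\<^sup>2 + q) * w - b / w) / sqrt w) * indicator {0<..} w) \<partial>lborel)"
        proof (intro nn_integral_cong)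
          fix w :: real
          show "?F q y w = ennreal K * (ennreal (exp (- (y\<^sup>2 + q) * w - b / w) / sqrt w) * indicator {0<..} w)"
          proof (cases "w > 0")
            case True
            have eq: "A w q * B w y * C w = K * (exp (- (y\<^sup>2 + q) * w - b / w) / sqrt w)"
            proof -
              have "exp (- (1 + w) * q) * exp (- (2 + w) * y\<^sup>2 - 2 * z * y) * exp (- b / w) =
                 exp (- q) * exp (- 2 * y\<^sup>2 - 2 * z * y) * exp (- (y\<^sup>2 + q) * w - b / w)"
                by (simp add: exp_add [symmetric] algebra_simps)
              then show ?thesis
                by (simp add: A_def B_def C_def K_def mult_ac)
            qed
            show ?thesis
              unfolding eq ennreal_mult'[OF K] using q True by simp
          qed auto
        qed
        also have "\<dots> = ennreal K * (\<integral>\<^sup>+w\<in>{0<..}. ennreal (exp (- (y\<^sup>2 + q) * w - b / w) / sqrt w) \<partial>lborel)"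
          by (rule nn_integral_cmult) simp
        also have "\<dots> = ennreal (K * (sqrt (pi / (y\<^sup>2 + q)) * exp (- 2 * sqrt ((y\<^sup>2 + q) * b))))"
          by (subst nn_integral_exp_neg_linear_neg_inverse[OF a b]) (simp only: ennreal_mult'[OF K])
        also have "K * (sqrt (pi / (y\<^sup>2 + q)) * exp (- 2 * sqrt ((y\<^sup>2 + q) * b))) =
            q powr (\<nu> - 1) * exp (- q) * (exp (- 2 * y\<^sup>2 - 2 * z * y - 2 * sqrt b * sqrt (y\<^sup>2 + q)) / sqrt (y\<^sup>2 + q))"
        proof -
          have "exp (- 2 * y\<^sup>2 - 2 * z * y - 2 * sqrt b * sqrt (y\<^sup>2 + q)) = exp (- 2 * y\<^sup>2 - 2 * z * y) * exp (- 2 * sqrt ((y\<^sup>2 + q) * b))"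
            by (simp add: exp_add [symmetric] real_sqrt_mult)
          then show ?thesis by (simp add: K_def real_sqrt_divide)
        qed
        finally show ?thesis by simp
      qed
      then show ?thesis using q by simp
    qed auto
  qed
  also have "\<dots> = (\<integral>\<^sup>+q. (\<integral>\<^sup>+w. (\<integral>\<^sup>+y. ?F q y w \<partial>lborel) \<partial>lborel) \<partial>lborel)"
    by (intro nn_integral_cong lborel_pair.Fubini') measurable
  also have "\<dots> = (\<integral>\<^sup>+w. (\<integral>\<^sup>+q. (\<integral>\<^sup>+y. ?F q y w \<partial>lborel) \<partial>lborel) \<partial>lborel)"
    by (intro lborel_pair.Fubini') measurable
  also have "\<dots> = (\<integral>\<^sup>+w. ennreal (Gamma \<nu>) * (ennreal (cylinder_weight \<nu> w * exp (z\<^sup>2 / (2 + w) - b / w)) * indicator {0<..} w) \<partial>lborel)"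
  proof (intro nn_integral_cong)
    fix w :: real
    show "(\<integral>\<^sup>+q. (\<integral>\<^sup>+y. ?F q y w \<partial>lborel) \<partial>lborel) =
      ennreal (Gamma \<nu>) * (ennreal (cylinder_weight \<nu> w * exp (z\<^sup>2 / (2 + w) - b / w)) * indicator {0<..} w)"
    proof (cases "w > 0")
      case w: True
      define L where "L = sqrt (pi / (2 + w)) * exp (z\<^sup>2 / (2 + w))"
      have L: "L \<ge> 0" using w by (simp add: L_def)
      have "(\<integral>\<^sup>+y. ?F q y w \<partial>lborel) = ennreal (A w q) * indicator {0<..} q * ennreal (C w * L)" for q
      proof -
        have "(\<integral>\<^sup>+y. ?F q y w \<partial>lborel) = (\<integral>\<^sup>+y. (ennreal (A w q) * indicator {0<..} q * ennreal (C w)) * ennreal (B w y) \<partial>lborel)"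
          using w nonneg by (intro nn_integral_cong) (simp add: ennreal_mult mult_ac)
        also have "\<dots> = (ennreal (A w q) * indicator {0<..} q * ennreal (C w)) * (\<integral>\<^sup>+y. ennreal (B w y) \<partial>lborel)"
          by (rule nn_integral_cmult) measurable
        also have "(\<integral>\<^sup>+y. ennreal (B w y) \<partial>lborel) = ennreal L"
          unfolding B_def L_def using w by (intro nn_integral_Gaussian_linear) auto
        finally show ?thesis
          using w nonneg L by (simp add: ennreal_mult mult_ac)
      qed
      then have "(\<integral>\<^sup>+q. (\<integral>\<^sup>+y. ?F q y w \<partial>lborel) \<partial>lborel) = (\<integral>\<^sup>+q. ennreal (A w q) * indicator {0<..} q * ennreal (C w * L) \<partial>lborel)"
        by simp
      also have "\<dots> = (\<integral>\<^sup>+q\<in>{0<..}. ennreal (A w q) \<partial>lborel) * ennreal (C w * L)"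
        by (rule nn_integral_multc) measurable
      also have "(\<integral>\<^sup>+q\<in>{0<..}. ennreal (A w q) \<partial>lborel) = ennreal (Gamma \<nu> / (1 + w) powr \<nu>)"
        unfolding A_def using w by (intro nn_integral_Gamma_scaled \<nu>) auto
      also have "ennreal (Gamma \<nu> / (1 + w) powr \<nu>) * ennreal (C w * L) = ennreal (Gamma \<nu> / (1 + w) powr \<nu> * (C w * L))"
        using w nonneg L by (subst ennreal_mult'') auto
      also have "Gamma \<nu> / (1 + w) powr \<nu> * (C w * L) = Gamma \<nu> * (cylinder_weight \<nu> w * exp (z\<^sup>2 / (2 + w) - b / w))"
      proof -
        have "exp (z\<^sup>2 / (2 + w) - b / w) = exp (- b / w) * exp (z\<^sup>2 / (2 + w))"
          by (simp add: exp_add [symmetric])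
        then show ?thesis
          using w by (simp add: C_def L_def cylinder_weight_def real_sqrt_divide real_sqrt_mult powr_minus_divide)
      qed
      also have "ennreal (Gamma \<nu> * (cylinder_weight \<nu> w * exp (z\<^sup>2 / (2 + w) - b / w))) = ennreal (Gamma \<nu>) * ennreal (cylinder_weight \<nu> w * exp (z\<^sup>2 / (2 + w) - b / w))"
        using Gamma_real_pos[OF \<nu>] by (intro ennreal_mult') auto
      finally show ?thesis using w by simp
    qed auto
  qed
  also have "\<dots> = ennreal (Gamma \<nu>) * (\<integral>\<^sup>+w\<in>{0<..}. ennreal (cylinder_weight \<nu> w * exp (z\<^sup>2 / (2 + w) - b / w)) \<partial>lborel)"
    by (rule nn_integral_cmult) (simp add: cylinder_weight_def)
  finally show ?thesis .
qed

lemma cylinder_integral_mult_neg: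
  assumes "\<nu> > 0"
  shows "cylinder_integral \<nu> z * cylinder_integral \<nu> (- z) =
    ennreal (Gamma \<nu>) * (\<integral>\<^sup>+w\<in>{0<..}. ennreal (cylinder_weight \<nu> w * exp (z\<^sup>2 / (2 + w))) \<partial>lborel)"
proof -
  have eq: "- 2 * y\<^sup>2 - z * (R + y) - (- z) * (R - y) = - 2 * y\<^sup>2 - 2 * z * y - 2 * sqrt 0 * R" for R y :: real
    by (simp add: algebra_simps)
  show ?thesis
    using nn_integral_cylinder_kernel[OF assms, of 0 z] unfolding cylinder_integral_product eq by simp
qed

text \<open>The sign condition makes the exponent -2 z sqrt (y^2 + q) equal to -2 sqrt b sqrt (y^2 +
  q) with b = z^2.\<close>

lemma cylinder_integral_square:
  assumes "\<nu> > 0" "z \<ge> 0"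
  shows "cylinder_integral \<nu> z * cylinder_integral \<nu> z =
    ennreal (Gamma \<nu>) * (\<integral>\<^sup>+w\<in>{0<..}. ennreal (cylinder_weight \<nu> w * exp (- z\<^sup>2 / w)) \<partial>lborel)"
proof -
  have eq: "- 2 * y\<^sup>2 - z * (R + y) - z * (R - y) = - 2 * y\<^sup>2 - 2 * 0 * y - 2 * sqrt (z\<^sup>2) * R" for R y :: real
    using assms(2) by (simp add: algebra_simps)
  show ?thesis
    using nn_integral_cylinder_kernel[OF assms(1), of "z\<^sup>2" 0] unfolding cylinder_integral_product eq by simp
qed

section \<open>Power series of the integral representation\<close>

text \<open>For \<mu> > 0, the integral of t^{\<mu> - 1} exp (-t^2 / 2) over the positive axis, by
  \<open>nn_integral_Gaussian_moment\<close>; that is, J(0) for parameter \<mu>.\<close>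

definition gaussian_moment :: "real \<Rightarrow> real" where
  "gaussian_moment \<mu> = 2 powr (\<mu> / 2 - 1) * Gamma (\<mu> / 2)"

definition kummer_real :: "real \<Rightarrow> real \<Rightarrow> real \<Rightarrow> real" where
  "kummer_real a m r = (\<Sum>n. pochhammer a n / pochhammer m n * (r ^ n / fact n))"

lemma kummer_of_real:
  assumes "a \<ge> 0" "m > 0" "r \<ge> 0"
  shows "kummer (of_real a) (of_real m) (of_real r) = of_real (kummer_real a m r)"
proof -
  have "(\<lambda>n. pochhammer a n / pochhammer m n * (r ^ n / fact n)) sums kummer_real a m r"
    unfolding kummer_real_def by (intro summable_sums summable_kummer_real assms)
  then have "(\<lambda>n. of_real (pochhammer a n / pochhammer m n * (r ^ n / fact n)) :: complex) sums of_real (kummer_real a m r)"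
    by (rule sums_of_real)
  then show ?thesis
    unfolding kummer_def by (simp add: sums_iff pochhammer_of_real)
qed

lemma gaussian_moment_pos: "\<mu> > 0 \<Longrightarrow> gaussian_moment \<mu> > 0"
  by (simp add: gaussian_moment_def Gamma_real_pos)

lemma gaussian_moment_plus_even:
  assumes "\<mu> > 0"
  shows "gaussian_moment (\<mu> + 2 * real j) = gaussian_moment \<mu> * 2 ^ j * pochhammer (\<mu> / 2) j"
proof -
  have "pochhammer (\<mu> / 2) j = Gamma (\<mu> / 2 + real j) / Gamma (\<mu> / 2)"
    by (rule pochhammer_Gamma) (use assms in \<open>auto elim!: nonpos_Ints_cases\<close>)
  moreover have "Gamma (\<mu> / 2) > 0" using assms by (intro Gamma_real_pos) auto
  moreover have "2 powr ((\<mu> + 2 * real j) / 2 - 1) = 2 powr (\<mu> / 2 - 1) * 2 ^ j"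
  proof -
    have "(\<mu> + 2 * real j) / 2 - 1 = (\<mu> / 2 - 1) + real j" by simp
    then show ?thesis by (simp only: powr_add) (simp add: powr_realpow)
  qed
  ultimately show ?thesis
    by (simp add: gaussian_moment_def add_divide_distrib)
qed

text \<open>Since (2 j)! = 4^j (1/2)_j j! and the moment gains 2^j (\<nu>/2)_j, termwise integration
  of the cosh series produces a Kummer series in z^2 / 2.\<close>

lemma gaussian_moment_even_term:
  assumes "\<nu> > 0"
  shows "z ^ (2 * j) / fact (2 * j) * gaussian_moment (\<nu> + real (2 * j)) =
    gaussian_moment \<nu> * (pochhammer (\<nu> / 2) j / pochhammer (1 / 2) j * ((z\<^sup>2 / 2) ^ j / fact j))"
proof -
  have "fact (2 * j) = (4 ^ j * pochhammer (1 / 2) j * fact j :: real)"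
    using fact_double[of j, where ?'a = real] by (simp add: power_mult)
  moreover have "(z\<^sup>2 / 2) ^ j = z ^ (2 * j) * 2 ^ j / 4 ^ j"
  proof -
    have "(z\<^sup>2 / 2) ^ j = (z\<^sup>2 * 2 / 4) ^ j" by simp
    then show ?thesis by (simp only: power_divide power_mult_distrib power_mult)
  qed
  moreover have "pochhammer (1 / 2 :: real) j > 0" by (simp add: pochhammer_pos)
  ultimately show ?thesis
    using gaussian_moment_plus_even[OF assms, of j] by (simp add: field_simps)
qed

text \<open>The even case at \<nu> + 1, with one more factor 2 j + 1 from the factorial, which turns
  (1/2)_j into (3/2)_j.\<close>

lemma gaussian_moment_odd_term:
  assumes "\<nu> > 0"
  shows "z ^ Suc (2 * j) / fact (Suc (2 * j)) * gaussian_moment (\<nu> + real (Suc (2 * j))) =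
    gaussian_moment (\<nu> + 1) * z * (pochhammer ((\<nu> + 1) / 2) j / pochhammer (3 / 2) j * ((z\<^sup>2 / 2) ^ j / fact j))"
proof -
  have "pochhammer (1 / 2 :: real) (Suc j) = 1 / 2 * pochhammer (1 / 2 + 1) j"
    by (rule pochhammer_rec)
  moreover have "pochhammer (1 / 2 :: real) (Suc j) = (1 / 2 + real j) * pochhammer (1 / 2) j"
    by (rule pochhammer_rec')
  moreover have "1 / 2 + 1 = (3 / 2 :: real)"
    by simp
  ultimately have "1 / 2 * pochhammer (3 / 2 :: real) j = (1 / 2 + real j) * pochhammer (1 / 2) j"
    by metis
  then have p: "pochhammer (3 / 2 :: real) j = (2 * real j + 1) * pochhammer (1 / 2) j"
    by (simp add: field_simps)
  have "z ^ Suc (2 * j) / fact (Suc (2 * j)) * gaussian_moment (\<nu> + real (Suc (2 * j))) =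
     z / (2 * real j + 1) * (z ^ (2 * j) / fact (2 * j) * gaussian_moment (\<nu> + 1 + real (2 * j)))"
    by (simp add: add_ac)
  also have "\<dots> = z / (2 * real j + 1) * (gaussian_moment (\<nu> + 1) * (pochhammer ((\<nu> + 1) / 2) j / pochhammer (1 / 2) j * ((z\<^sup>2 / 2) ^ j / fact j)))"
    by (subst gaussian_moment_even_term) (use assms in auto)
  also have "\<dots> = gaussian_moment (\<nu> + 1) * z * (pochhammer ((\<nu> + 1) / 2) j / pochhammer (3 / 2) j * ((z\<^sup>2 / 2) ^ j / fact j))"
    unfolding p by (simp add: mult_ac)
  finally show ?thesis .
qed

text \<open>With nonnegative coefficients, sum and integral commute in \<open>ennreal\<close>. The
  exponents \<open>k j\<close> allow series over even or odd powers only, for cosh and sinh.\<close>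

lemma nn_integral_power_series_moments:
  fixes c :: "nat \<Rightarrow> real" and k :: "nat \<Rightarrow> nat"
  assumes \<nu>: "\<nu> > 0" and c: "\<And>j. c j \<ge> 0" and F: "\<And>t. t > 0 \<Longrightarrow> (\<lambda>j. c j * t ^ k j) sums F t"
    and S: "(\<lambda>j. c j * gaussian_moment (\<nu> + real (k j))) sums S"
  shows "(\<integral>\<^sup>+t\<in>{0<..}. ennreal (t powr (\<nu> - 1) * exp (- t\<^sup>2 / 2) * F t) \<partial>lborel) = ennreal S"
proof -
  let ?f = "\<lambda>j t. ennreal (c j) * (ennreal (t powr (\<nu> + real (k j) - 1) * exp (- t\<^sup>2 / 2)) * indicator {0<..} t)"
  have "(\<integral>\<^sup>+t\<in>{0<..}. ennreal (t powr (\<nu> - 1) * exp (- t\<^sup>2 / 2) * F t) \<partial>lborel) = (\<integral>\<^sup>+t. (\<Sum>j. ?f j t) \<partial>lborel)"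
  proof (intro nn_integral_cong)
    fix t :: real
    show "ennreal (t powr (\<nu> - 1) * exp (- t\<^sup>2 / 2) * F t) * indicator {0<..} t = (\<Sum>j. ?f j t)"
    proof (cases "t > 0")
      case t: True
      have "(\<lambda>j. t powr (\<nu> - 1) * exp (- t\<^sup>2 / 2) * (c j * t ^ k j)) sums (t powr (\<nu> - 1) * exp (- t\<^sup>2 / 2) * F t)"
        by (intro sums_mult F t)
      also have "(\<lambda>j. t powr (\<nu> - 1) * exp (- t\<^sup>2 / 2) * (c j * t ^ k j)) = (\<lambda>j. c j * (t powr (\<nu> + real (k j) - 1) * exp (- t\<^sup>2 / 2)))"
      proof
        fix j
        have "t powr (\<nu> + real (k j) - 1) = t powr (\<nu> - 1) * t ^ k j"
          using t by (simp add: powr_add [symmetric] powr_realpow [symmetric] algebra_simps)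
        then show "t powr (\<nu> - 1) * exp (- t\<^sup>2 / 2) * (c j * t ^ k j) = c j * (t powr (\<nu> + real (k j) - 1) * exp (- t\<^sup>2 / 2))"
          by simp
      qed
      finally have *: "(\<lambda>j. c j * (t powr (\<nu> + real (k j) - 1) * exp (- t\<^sup>2 / 2))) sums (t powr (\<nu> - 1) * exp (- t\<^sup>2 / 2) * F t)" .
      have "(\<Sum>j. ennreal (c j * (t powr (\<nu> + real (k j) - 1) * exp (- t\<^sup>2 / 2)))) = ennreal (t powr (\<nu> - 1) * exp (- t\<^sup>2 / 2) * F t)"
        by (intro suminf_ennreal_eq[OF _ *] mult_nonneg_nonneg c) auto
      then show ?thesis
        using t unfolding ennreal_mult'[OF c] by simp
    qed auto
  qed
  also have "\<dots> = (\<Sum>j. \<integral>\<^sup>+t. ?f j t \<partial>lborel)"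
    by (rule nn_integral_suminf) measurable
  also have "\<dots> = (\<Sum>j. ennreal (c j * gaussian_moment (\<nu> + real (k j))))"
  proof (intro suminf_cong)
    fix j
    have "(\<integral>\<^sup>+t. ?f j t \<partial>lborel) = ennreal (c j) * (\<integral>\<^sup>+t\<in>{0<..}. ennreal (t powr (\<nu> + real (k j) - 1) * exp (- t\<^sup>2 / 2)) \<partial>lborel)"
      by (rule nn_integral_cmult) measurable
    also have "\<dots> = ennreal (c j) * ennreal (gaussian_moment (\<nu> + real (k j)))"
      unfolding gaussian_moment_def by (subst nn_integral_Gaussian_moment) (use \<nu> in auto)
    finally show "(\<integral>\<^sup>+t. ?f j t \<partial>lborel) = ennreal (c j * gaussian_moment (\<nu> + real (k j)))"
      unfolding ennreal_mult'[OF c] .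
  qed
  also have "\<dots> = ennreal S"
    by (intro suminf_ennreal_eq[OF _ S] mult_nonneg_nonneg c less_imp_le[OF gaussian_moment_pos]) (use \<nu> in auto)
  finally show ?thesis .
qed

text \<open>The even part of J in z. With \<open>cylinder_odd\<close>, which is minus the odd part,
  J(z) is even - odd and J(-z) is even + odd.\<close>

definition cylinder_even :: "real \<Rightarrow> real \<Rightarrow> real" where
  "cylinder_even \<nu> z = gaussian_moment \<nu> * kummer_real (\<nu> / 2) (1 / 2) (z\<^sup>2 / 2)"

definition cylinder_odd :: "real \<Rightarrow> real \<Rightarrow> real" where
  "cylinder_odd \<nu> z = gaussian_moment (\<nu> + 1) * z * kummer_real ((\<nu> + 1) / 2) (3 / 2) (z\<^sup>2 / 2)"

lemma nn_integral_cosh: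
  assumes \<nu>: "\<nu> > 0"
  shows "(\<integral>\<^sup>+t\<in>{0<..}. ennreal (t powr (\<nu> - 1) * exp (- t\<^sup>2 / 2) * cosh (z * t)) \<partial>lborel) = ennreal (cylinder_even \<nu> z)"
proof (rule nn_integral_power_series_moments[OF \<nu>, where k = "\<lambda>j. 2 * j" and c = "\<lambda>j. z ^ (2 * j) / fact (2 * j)"])
  show "(\<lambda>j. z ^ (2 * j) / fact (2 * j) * gaussian_moment (\<nu> + real (2 * j))) sums cylinder_even \<nu> z"
    unfolding gaussian_moment_even_term[OF \<nu>] cylinder_even_def kummer_real_def
    by (intro sums_mult summable_sums summable_kummer_real) (use \<nu> in auto)
  show "(\<lambda>j. z ^ (2 * j) / fact (2 * j) * t ^ (2 * j)) sums cosh (z * t)" for t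
  proof -
    have "(\<lambda>j. (\<lambda>n. if even n then (z * t) ^ n /\<^sub>R fact n else 0) (2 * j)) sums cosh (z * t)"
      by (subst sums_mono_reindex) (use cosh_converges[of "z * t"] in \<open>auto simp: strict_mono_def elim!: evenE\<close>)
    then show ?thesis by (simp add: power_mult_distrib field_simps)
  qed
qed auto

lemma nn_integral_sinh:
  assumes \<nu>: "\<nu> > 0" and z: "z \<ge> 0"
  shows "(\<integral>\<^sup>+t\<in>{0<..}. ennreal (t powr (\<nu> - 1) * exp (- t\<^sup>2 / 2) * sinh (z * t)) \<partial>lborel) = ennreal (cylinder_odd \<nu> z)"
proof (rule nn_integral_power_series_moments[OF \<nu>, where k = "\<lambda>j. Suc (2 * j)" and c = "\<lambda>j. z ^ Suc (2 * j) / fact (Suc (2 * j))"])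
  show "(\<lambda>j. z ^ Suc (2 * j) / fact (Suc (2 * j)) * gaussian_moment (\<nu> + real (Suc (2 * j)))) sums cylinder_odd \<nu> z"
    unfolding gaussian_moment_odd_term[OF \<nu>] cylinder_odd_def kummer_real_def
    by (intro sums_mult summable_sums summable_kummer_real) (use \<nu> in auto)
  show "(\<lambda>j. z ^ Suc (2 * j) / fact (Suc (2 * j)) * t ^ Suc (2 * j)) sums sinh (z * t)" for t
  proof -
    have "(\<lambda>j. (\<lambda>n. if even n then 0 else (z * t) ^ n /\<^sub>R fact n) (Suc (2 * j))) sums sinh (z * t)"
      by (subst sums_mono_reindex) (use sinh_converges[of "z * t"] in \<open>auto simp: strict_mono_def elim!: oddE\<close>)
    then show ?thesis by (simp add: power_mult_distrib field_simps del: fact_Suc power_Suc)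
  qed
  show "z ^ Suc (2 * j) / fact (Suc (2 * j)) \<ge> 0" for j
    using z by (intro divide_nonneg_pos zero_le_power) auto
qed

lemma cylinder_even_nonneg: "\<nu> > 0 \<Longrightarrow> cylinder_even \<nu> z \<ge> 0"
  unfolding cylinder_even_def kummer_real_def
  by (intro mult_nonneg_nonneg less_imp_le[OF gaussian_moment_pos] suminf_nonneg summable_kummer_real)
     (auto simp: pochhammer_prod intro!: prod_nonneg divide_nonneg_nonneg)

lemma cylinder_odd_nonneg: "\<nu> > 0 \<Longrightarrow> z \<ge> 0 \<Longrightarrow> cylinder_odd \<nu> z \<ge> 0"
  unfolding cylinder_odd_def kummer_real_def
  by (intro mult_nonneg_nonneg less_imp_le[OF gaussian_moment_pos] suminf_nonneg summable_kummer_real)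
     (auto simp: pochhammer_prod intro!: prod_nonneg divide_nonneg_nonneg)

lemma borel_measurable_cosh_sinh [measurable]:
  fixes f :: "'a \<Rightarrow> real"
  assumes [measurable]: "f \<in> borel_measurable M"
  shows "(\<lambda>x. cosh (f x)) \<in> borel_measurable M" "(\<lambda>x. sinh (f x)) \<in> borel_measurable M"
  unfolding cosh_def sinh_def by measurable

lemma cylinder_integral_neg_eq:
  assumes \<nu>: "\<nu> > 0" and z: "z \<ge> 0"
  shows "cylinder_integral \<nu> (- z) = ennreal (cylinder_even \<nu> z + cylinder_odd \<nu> z)"
proof -
  let ?g = "\<lambda>t. t powr (\<nu> - 1) * exp (- t\<^sup>2 / 2)"
  have "cylinder_integral \<nu> (- z) = (\<integral>\<^sup>+t. ennreal (?g t * cosh (z * t)) * indicator {0<..} t + ennreal (?g t * sinh (z * t)) * indicator {0<..} t \<partial>lborel)"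
    unfolding cylinder_integral_def
  proof (intro nn_integral_cong)
    fix t :: real
    have "t powr (\<nu> - 1) * exp (- t\<^sup>2 / 2 - - z * t) = ?g t * cosh (z * t) + ?g t * sinh (z * t)"
      using cosh_plus_sinh[of "z * t"] by (simp add: exp_add [symmetric] ring_distribs [symmetric])
    then show "ennreal (t powr (\<nu> - 1) * exp (- t\<^sup>2 / 2 - - z * t)) * indicator {0<..} t =
       ennreal (?g t * cosh (z * t)) * indicator {0<..} t + ennreal (?g t * sinh (z * t)) * indicator {0<..} t"
      using z by (cases "t > 0") (simp_all add: ennreal_plus [symmetric] cosh_real_nonneg del: ennreal_plus)
  qed
  also have "\<dots> = ennreal (cylinder_even \<nu> z) + ennreal (cylinder_odd \<nu> z)"
    unfolding nn_integral_cosh[OF \<nu>, symmetric] nn_integral_sinh[OF \<nu> z, symmetric]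
    by (rule nn_integral_add) measurable
  also have "\<dots> = ennreal (cylinder_even \<nu> z + cylinder_odd \<nu> z)"
    using cylinder_even_nonneg[OF \<nu>] cylinder_odd_nonneg[OF \<nu> z] by (simp add: ennreal_plus)
  finally show ?thesis .
qed

text \<open>From exp (-z t) + sinh (z t) = cosh (z t): the odd part is added instead of subtracted,
  and being finite it can be cancelled in \<open>ennreal\<close>. The order of the two parts comes
  along.\<close>

lemma cylinder_integral_eq:
  assumes \<nu>: "\<nu> > 0" and z: "z \<ge> 0"
  shows "cylinder_integral \<nu> z = ennreal (cylinder_even \<nu> z - cylinder_odd \<nu> z)" "cylinder_odd \<nu> z \<le> cylinder_even \<nu> z"
proof -
  let ?g = "\<lambda>t. t powr (\<nu> - 1) * exp (- t\<^sup>2 / 2)"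
  have "cylinder_integral \<nu> z + ennreal (cylinder_odd \<nu> z) =
      (\<integral>\<^sup>+t. ennreal (?g t * exp (- (z * t))) * indicator {0<..} t + ennreal (?g t * sinh (z * t)) * indicator {0<..} t \<partial>lborel)"
  proof -
    have "cylinder_integral \<nu> z = (\<integral>\<^sup>+t\<in>{0<..}. ennreal (?g t * exp (- (z * t))) \<partial>lborel)"
      unfolding cylinder_integral_def
      by (intro nn_integral_cong) (simp add: mult.assoc exp_add [symmetric])
    then show ?thesis
      unfolding nn_integral_sinh[OF \<nu> z, symmetric] by (simp only:) (rule nn_integral_add [symmetric], measurable)
  qed
  also have "\<dots> = ennreal (cylinder_even \<nu> z)"
    unfolding nn_integral_cosh[OF \<nu>, symmetric]
  proof (intro nn_integral_cong)
    fix t :: real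
    have "?g t * exp (- (z * t)) + ?g t * sinh (z * t) = ?g t * cosh (z * t)"
      using cosh_minus_sinh[of "z * t"] by (simp add: ring_distribs [symmetric])
    then show "ennreal (?g t * exp (- (z * t))) * indicator {0<..} t + ennreal (?g t * sinh (z * t)) * indicator {0<..} t =
       ennreal (?g t * cosh (z * t)) * indicator {0<..} t"
      using z by (cases "t > 0") (simp_all add: ennreal_plus [symmetric] del: ennreal_plus)
  qed
  finally have *: "cylinder_integral \<nu> z + ennreal (cylinder_odd \<nu> z) = ennreal (cylinder_even \<nu> z)" .
  have "ennreal (cylinder_odd \<nu> z) \<le> ennreal (cylinder_even \<nu> z)"
    unfolding * [symmetric] by simp
  then show "cylinder_odd \<nu> z \<le> cylinder_even \<nu> z"
    using cylinder_even_nonneg[OF \<nu>] by simp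
  have "cylinder_integral \<nu> z = ennreal (cylinder_even \<nu> z) - ennreal (cylinder_odd \<nu> z)"
    unfolding * [symmetric] by simp
  then show "cylinder_integral \<nu> z = ennreal (cylinder_even \<nu> z - cylinder_odd \<nu> z)"
    using cylinder_odd_nonneg[OF \<nu> z] by (simp add: ennreal_minus)
qed

text \<open>Legendre's duplication at \<nu> / 2, arranged so that the two moments show the
  coefficients of the Kummer functions in D_{-\<nu>}, times Gamma \<nu>.\<close>

lemma gaussian_moment_duplication:
  assumes "\<nu> > 0"
  shows "gaussian_moment \<nu> = 2 powr (- \<nu> / 2) * sqrt pi * rGamma ((\<nu> + 1) / 2) * Gamma \<nu>"
    and "gaussian_moment (\<nu> + 1) = 2 powr (- \<nu> / 2) * sqrt (2 * pi) * rGamma (\<nu> / 2) * Gamma \<nu>"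
proof -
  have np: "w \<notin> \<int>\<^sub>\<le>\<^sub>0" if "Re w > 0" for w :: complex
    using that by (auto elim!: nonpos_Ints_cases)
  have "Gamma (of_real (\<nu> / 2)) * Gamma (of_real (\<nu> / 2) + 1 / 2) =
      exp ((1 - 2 * of_real (\<nu> / 2)) * of_real (ln 2)) * of_real (sqrt pi) * Gamma (2 * of_real (\<nu> / 2) :: complex)"
    by (rule Gamma_legendre_duplication) (use assms in \<open>auto intro!: np\<close>)
  also have "of_real (\<nu> / 2) + 1 / 2 = (of_real ((\<nu> + 1) / 2) :: complex)"
    by (simp add: add_divide_distrib)
  also have "2 * of_real (\<nu> / 2) = (of_real \<nu> :: complex)"
    by simp
  also have "exp ((1 - of_real \<nu>) * of_real (ln 2)) = (of_real (2 powr (1 - \<nu>)) :: complex)"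
    by (simp add: powr_def exp_of_real [symmetric])
  finally have "of_real (Gamma (\<nu> / 2) * Gamma ((\<nu> + 1) / 2)) = (of_real (2 powr (1 - \<nu>) * sqrt pi * Gamma \<nu>) :: complex)"
    by (simp only: Gamma_complex_of_real of_real_mult)
  then have dup: "Gamma (\<nu> / 2) * Gamma ((\<nu> + 1) / 2) = 2 powr (1 - \<nu>) * sqrt pi * Gamma \<nu>"
    by (simp only: of_real_eq_iff)
  have pos: "Gamma (\<nu> / 2) > 0" "Gamma ((\<nu> + 1) / 2) > 0"
    using assms by (auto intro!: Gamma_real_pos)
  have "2 powr (\<nu> / 2 - 1) * 2 powr (1 - \<nu>) = (2 powr (- \<nu> / 2) :: real)"
    by (simp add: powr_add [symmetric])
  moreover have "Gamma (\<nu> / 2) = 2 powr (1 - \<nu>) * sqrt pi * Gamma \<nu> * rGamma ((\<nu> + 1) / 2)"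
    using pos[THEN less_imp_neq] by (simp add: rGamma_inverse_Gamma dup [symmetric])
  ultimately show "gaussian_moment \<nu> = 2 powr (- \<nu> / 2) * sqrt pi * rGamma ((\<nu> + 1) / 2) * Gamma \<nu>"
    unfolding gaussian_moment_def by simp
  have "2 powr ((\<nu> + 1) / 2 - 1) * 2 powr (1 - \<nu>) = (2 powr (- \<nu> / 2 + 1 / 2) :: real)"
    by (simp add: powr_add [symmetric] field_simps)
  also have "\<dots> = 2 powr (- \<nu> / 2) * 2 powr (1 / 2)"
    by (rule powr_add)
  also have "2 powr (1 / 2) = sqrt 2"
    by (rule powr_half_sqrt) simp
  finally have "2 powr ((\<nu> + 1) / 2 - 1) * 2 powr (1 - \<nu>) = (2 powr (- \<nu> / 2) * sqrt 2 :: real)" .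
  moreover have "Gamma ((\<nu> + 1) / 2) = 2 powr (1 - \<nu>) * sqrt pi * Gamma \<nu> * rGamma (\<nu> / 2)"
    using pos[THEN less_imp_neq] by (simp add: rGamma_inverse_Gamma dup [symmetric])
  ultimately show "gaussian_moment (\<nu> + 1) = 2 powr (- \<nu> / 2) * sqrt (2 * pi) * rGamma (\<nu> / 2) * Gamma \<nu>"
    unfolding gaussian_moment_def by (simp add: real_sqrt_mult)
qed

text \<open>A pure comparison of Kummer series, so z may have either sign; the value at -z is needed
  for the mixed product.\<close>

lemma parabolic_cylinder_D_of_real:
  assumes "\<nu> > 0"
  shows "parabolic_cylinder_D (- of_real \<nu>) (of_real z) =
    of_real (exp (- z\<^sup>2 / 4) / Gamma \<nu> * (cylinder_even \<nu> z - cylinder_odd \<nu> z))"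
proof -
  have G: "Gamma \<nu> > 0" using assms by (rule Gamma_real_pos)
  have k1: "kummer (of_real \<nu> / 2) (1 / 2) ((of_real z)\<^sup>2 / 2) = of_real (kummer_real (\<nu> / 2) (1 / 2) (z\<^sup>2 / 2))"
    using kummer_of_real[of "\<nu> / 2" "1 / 2" "z\<^sup>2 / 2"] assms by simp
  have k2: "kummer ((of_real \<nu> + 1) / 2) (3 / 2) ((of_real z)\<^sup>2 / 2) = of_real (kummer_real ((\<nu> + 1) / 2) (3 / 2) (z\<^sup>2 / 2))"
    using kummer_of_real[of "(\<nu> + 1) / 2" "3 / 2" "z\<^sup>2 / 2"] assms by simp
  have r1: "rGamma ((of_real \<nu> + 1) / 2 :: complex) = of_real (rGamma ((\<nu> + 1) / 2))"
    using rGamma_complex_of_real[of "(\<nu> + 1) / 2"] by simp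
  have r2: "rGamma (of_real \<nu> / 2 :: complex) = of_real (rGamma (\<nu> / 2))"
    using rGamma_complex_of_real[of "\<nu> / 2"] by simp
  have p: "(2 powr (- of_real \<nu> / 2) :: complex) = of_real (2 powr (- \<nu> / 2))"
    using powr_of_real[of 2 "- \<nu> / 2"] by simp
  have e: "exp (- ((of_real z)\<^sup>2) / 4 :: complex) = of_real (exp (- z\<^sup>2 / 4))"
    by (simp add: exp_of_real [symmetric])
  have args: "1 / 2 - - of_real \<nu> / 2 = (of_real \<nu> + 1 :: complex) / 2" "- (- of_real \<nu>) / 2 = (of_real \<nu> / 2 :: complex)"
    by (simp_all add: add_divide_distrib)
  show ?thesis
    unfolding parabolic_cylinder_D_def args k1 k2 r1 r2 p e cylinder_even_def cylinder_odd_def gaussian_moment_duplication[OF assms]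
    using G by (simp add: field_simps)
qed

section \<open>The identities for positive real parameters\<close>

definition weight_moment :: "real \<Rightarrow> real" where
  "weight_moment \<mu> = (gaussian_moment \<mu>)\<^sup>2 / Gamma \<mu>"

lemma cylinder_weight_nonneg: "w > 0 \<Longrightarrow> cylinder_weight \<mu> w \<ge> 0"
  by (simp add: cylinder_weight_def)

lemma borel_measurable_cylinder_weight [measurable]: "cylinder_weight \<mu> \<in> borel_measurable borel"
  unfolding cylinder_weight_def by measurable

lemma cylinder_even_at_0 [simp]: "cylinder_even \<nu> 0 = gaussian_moment \<nu>"
proof -
  have "(\<lambda>n. pochhammer (\<nu> / 2) n / pochhammer (1 / 2) n * (0 ^ n / fact n)) sums 1"
    using sums_finite[of "{0}" "\<lambda>n. pochhammer (\<nu> / 2) n / pochhammer (1 / 2) n * (0 ^ n / fact n)"] by simp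
  then show ?thesis
    by (simp add: cylinder_even_def kummer_real_def sums_iff)
qed

lemma cylinder_odd_at_0 [simp]: "cylinder_odd \<nu> 0 = 0"
  by (simp add: cylinder_odd_def)

text \<open>The total mass of the weight is read off the product formula at \<open>z = 0\<close>.\<close>

lemma has_bochner_integral_cylinder_weight:
  assumes \<mu>: "\<mu> > 0"
  shows "has_bochner_integral lborel (\<lambda>w. indicator {0<..} w * cylinder_weight \<mu> w) (weight_moment \<mu>)"
proof (rule has_bochner_integral_nn_integral)
  have G: "Gamma \<mu> > 0" using \<mu> by (rule Gamma_real_pos)
  have "ennreal (Gamma \<mu>) * (\<integral>\<^sup>+w\<in>{0<..}. ennreal (cylinder_weight \<mu> w) \<partial>lborel) = ennreal ((gaussian_moment \<mu>)\<^sup>2)"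
    using cylinder_integral_square[OF \<mu>, of 0] gaussian_moment_pos[OF \<mu>]
    by (simp add: cylinder_integral_eq[OF \<mu>] ennreal_mult' [symmetric] power2_eq_square)
  then have "ennreal (1 / Gamma \<mu>) * (ennreal (Gamma \<mu>) * (\<integral>\<^sup>+w\<in>{0<..}. ennreal (cylinder_weight \<mu> w) \<partial>lborel)) =
      ennreal (1 / Gamma \<mu>) * ennreal ((gaussian_moment \<mu>)\<^sup>2)"
    by simp
  moreover have "ennreal (1 / Gamma \<mu>) * ennreal (Gamma \<mu>) = 1"
    using G by (simp add: ennreal_mult' [symmetric])
  ultimately have "(\<integral>\<^sup>+w\<in>{0<..}. ennreal (cylinder_weight \<mu> w) \<partial>lborel) = ennreal (weight_moment \<mu>)"
    using G by (simp add: mult.assoc [symmetric] ennreal_mult' [symmetric] weight_moment_def)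
  moreover have "(\<integral>\<^sup>+w. ennreal (indicator {0<..} w * cylinder_weight \<mu> w) \<partial>lborel) = (\<integral>\<^sup>+w\<in>{0<..}. ennreal (cylinder_weight \<mu> w) \<partial>lborel)"
    by (intro nn_integral_cong) (auto simp: indicator_def)
  ultimately show "(\<integral>\<^sup>+w. ennreal (indicator {0<..} w * cylinder_weight \<mu> w) \<partial>lborel) = ennreal (weight_moment \<mu>)"
    by simp
  show "0 \<le> weight_moment \<mu>" using G by (simp add: weight_moment_def)
qed (auto simp: indicator_def cylinder_weight_nonneg)

text \<open>Abel's inequality: the weights s^i decrease from 1. The bound stays uniform up to s = 1,
  which s = 1 / (1 + w) approaches as w tends to 0.\<close>

lemma abs_partial_sum_power_le:
  fixes f :: "nat \<Rightarrow> real"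
  assumes C: "\<And>n. \<bar>\<Sum>i<n. f i\<bar> \<le> C" and s: "0 \<le> s" "s \<le> 1"
  shows "\<bar>\<Sum>i<n. f i * s ^ i\<bar> \<le> C"
proof -
  have d: "0 \<le> s ^ j - s ^ Suc j" for j
    using power_decreasing[of j "Suc j" s] s by simp
  have "\<bar>\<Sum>i<n. f i * s ^ i\<bar> \<le> (\<Sum>j<n. \<bar>(\<Sum>i<Suc j. f i) * (s ^ j - s ^ Suc j)\<bar>) + \<bar>(\<Sum>i<n. f i) * s ^ n\<bar>"
    unfolding sum_by_parts[of f] by (rule order.trans[OF abs_triangle_ineq add_right_mono[OF sum_abs]])
  also have "\<dots> \<le> (\<Sum>j<n. C * (s ^ j - s ^ Suc j)) + C * s ^ n"
  proof (intro add_mono sum_mono)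
    show "\<bar>(\<Sum>i<Suc j. f i) * (s ^ j - s ^ Suc j)\<bar> \<le> C * (s ^ j - s ^ Suc j)" for j
      unfolding abs_mult abs_of_nonneg[OF d] by (rule mult_right_mono[OF C d])
    show "\<bar>(\<Sum>i<n. f i) * s ^ n\<bar> \<le> C * s ^ n"
      unfolding abs_mult using s C[of 0] by (intro mult_mono C) auto
  qed
  also have "\<dots> = C"
    unfolding sum_distrib_left [symmetric] sum_lessThan_telescope' by (simp add: algebra_simps)
  finally show ?thesis .
qed

text \<open>Each factor (1 + w)^{-i} raises the parameter of the weight by i, so the partial sums
  integrate to combinations of total masses. C times the weight dominates them. \<open>L\<close>
  stands for a product of two cylinder integrals.\<close>

lemma weight_moment_sums:
  fixes f :: "nat \<Rightarrow> real" and F :: "real \<Rightarrow> real"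
  assumes \<nu>: "\<nu> > 0" and C: "\<And>n. \<bar>\<Sum>i<n. f i\<bar> \<le> C"
    and F: "\<And>w. w > 0 \<Longrightarrow> (\<lambda>n. f n * (1 / (1 + w)) ^ n) sums F w"
    and [measurable]: "F \<in> borel_measurable borel"
    and F0: "\<And>w. w > 0 \<Longrightarrow> F w \<ge> 0" and L0: "L \<ge> 0"
    and L: "ennreal L = ennreal (Gamma \<nu>) * (\<integral>\<^sup>+w\<in>{0<..}. ennreal (cylinder_weight \<nu> w * F w) \<partial>lborel)"
  shows "(\<lambda>n. f n * weight_moment (\<nu> + real n)) sums (L / Gamma \<nu>)"
proof -
  have G: "Gamma \<nu> > 0" using \<nu> by (rule Gamma_real_pos)
  define h where "h = (\<lambda>n w. indicator {0<..} w * cylinder_weight \<nu> w * (\<Sum>i<n. f i * (1 / (1 + w)) ^ i))"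
  have shift: "indicator {0<..} w * cylinder_weight \<nu> w * (1 / (1 + w)) ^ i = indicator {0<..} w * cylinder_weight (\<nu> + real i) w" for i and w :: real
    by (auto simp: indicator_def cylinder_weight_def powr_diff powr_realpow power_divide)
  have int: "has_bochner_integral lborel (h n) (\<Sum>i<n. f i * weight_moment (\<nu> + real i))" for n
  proof -
    have "has_bochner_integral lborel (\<lambda>w. \<Sum>i<n. f i * (indicator {0<..} w * cylinder_weight (\<nu> + real i) w)) (\<Sum>i<n. f i * weight_moment (\<nu> + real i))"
      by (intro has_bochner_integral_sum has_bochner_integral_mult_right has_bochner_integral_cylinder_weight) (use \<nu> in auto)
    also have "(\<lambda>w. \<Sum>i<n. f i * (indicator {0<..} w * cylinder_weight (\<nu> + real i) w)) = h n"
      unfolding h_def shift [symmetric] by (simp add: sum_distrib_left mult_ac)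
    finally show ?thesis .
  qed
  have "(\<lambda>n. integral\<^sup>L lborel (h n)) \<longlonglongrightarrow> (LINT w|lborel. indicator {0<..} w * cylinder_weight \<nu> w * F w)"
  proof (rule integral_dominated_convergence[where w = "\<lambda>w. C * (indicator {0<..} w * cylinder_weight \<nu> w)"])
    show "integrable lborel (\<lambda>w. C * (indicator {0<..} w * cylinder_weight \<nu> w))"
      using has_bochner_integral_cylinder_weight[OF \<nu>] by (intro integrable_mult_right) (auto simp: has_bochner_integral_iff)
    show "AE w in lborel. (\<lambda>n. h n w) \<longlonglongrightarrow> indicator {0<..} w * cylinder_weight \<nu> w * F w"
    proof (intro AE_I2)
      fix w :: real
      show "(\<lambda>n. h n w) \<longlonglongrightarrow> indicator {0<..} w * cylinder_weight \<nu> w * F w"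
      proof (cases "w > 0")
        case True
        then show ?thesis
          unfolding h_def by (intro tendsto_mult tendsto_const F[unfolded sums_def])
      qed (simp add: h_def)
    qed
    show "AE w in lborel. norm (h n w) \<le> C * (indicator {0<..} w * cylinder_weight \<nu> w)" for n
    proof (intro AE_I2)
      fix w :: real
      show "norm (h n w) \<le> C * (indicator {0<..} w * cylinder_weight \<nu> w)"
      proof (cases "w > 0")
        case True
        then have "\<bar>\<Sum>i<n. f i * (1 / (1 + w)) ^ i\<bar> \<le> C"
          by (intro abs_partial_sum_power_le C) auto
        then show ?thesis
          using True cylinder_weight_nonneg[OF True, of \<nu>] mult_left_mono[of "\<bar>\<Sum>i<n. f i * (1 / (1 + w)) ^ i\<bar>" C "cylinder_weight \<nu> w"]
          by (simp add: h_def abs_mult mult.commute)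
      qed (simp add: h_def)
    qed
    show "h n \<in> borel_measurable lborel" for n
      unfolding h_def by measurable
  qed measurable
  moreover have "integral\<^sup>L lborel (h n) = (\<Sum>i<n. f i * weight_moment (\<nu> + real i))" for n
    using int by (rule has_bochner_integral_integral_eq)
  moreover have "(LINT w|lborel. indicator {0<..} w * cylinder_weight \<nu> w * F w) = L / Gamma \<nu>"
  proof -
    have "ennreal (1 / Gamma \<nu>) * ennreal L = ennreal (1 / Gamma \<nu>) * ennreal (Gamma \<nu>) * (\<integral>\<^sup>+w\<in>{0<..}. ennreal (cylinder_weight \<nu> w * F w) \<partial>lborel)"
      by (simp add: L mult.assoc)
    also have "ennreal (1 / Gamma \<nu>) * ennreal (Gamma \<nu>) = 1"
      using G by (simp add: ennreal_mult' [symmetric])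
    finally have "(\<integral>\<^sup>+w\<in>{0<..}. ennreal (cylinder_weight \<nu> w * F w) \<partial>lborel) = ennreal (L / Gamma \<nu>)"
      using G L0 by (simp add: ennreal_mult' [symmetric])
    moreover have "(\<integral>\<^sup>+w. ennreal (indicator {0<..} w * cylinder_weight \<nu> w * F w) \<partial>lborel) = (\<integral>\<^sup>+w\<in>{0<..}. ennreal (cylinder_weight \<nu> w * F w) \<partial>lborel)"
      by (intro nn_integral_cong) (auto simp: indicator_def)
    ultimately have "has_bochner_integral lborel (\<lambda>w. indicator {0<..} w * cylinder_weight \<nu> w * F w) (L / Gamma \<nu>)"
      using F0 L0 G by (intro has_bochner_integral_nn_integral) (auto simp: indicator_def cylinder_weight_nonneg)
    then show ?thesis by (rule has_bochner_integral_integral_eq)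
  qed
  ultimately show ?thesis by (simp add: sums_def)
qed

text \<open>Identifies the masses of the weights with the coefficients. Only one of the two moment
  factors is rewritten by duplication: the powers of 2 then collapse to 1/2, and the Gamma quotient
  of \<open>product_coeff_eq_gamma_ratio\<close> remains.\<close>

lemma product_coeff_of_real:
  assumes \<nu>: "\<nu> > 0"
  shows "product_coeff n (of_real \<nu>) = of_real (weight_moment (\<nu> + real n) / (pi * Gamma \<nu>))"
proof -
  define \<mu> where "\<mu> = \<nu> + real n"
  have \<mu>: "\<mu> > 0" using \<nu> by (simp add: \<mu>_def)
  have G: "Gamma \<mu> > 0" "Gamma \<nu> > 0" using \<nu> \<mu> by (auto intro: Gamma_real_pos)
  have m: "gaussian_moment \<mu> = 2 powr (- \<mu> / 2) * sqrt pi * rGamma ((\<mu> + 1) / 2) * Gamma \<mu>"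
    by (rule gaussian_moment_duplication[OF \<mu>])
  have half: "2 powr (- \<mu> / 2) * 2 powr (\<mu> / 2 - 1) = (1 / 2 :: real)"
    by (simp only: powr_add [symmetric]) (simp add: powr_minus)
  have "weight_moment \<mu> = (2 powr (- \<mu> / 2) * 2 powr (\<mu> / 2 - 1)) * (sqrt pi * (Gamma (\<mu> / 2) * rGamma (\<mu> / 2 + 1 / 2)))"
    unfolding weight_moment_def power2_eq_square
    using G by (subst (2) m) (simp add: gaussian_moment_def add_divide_distrib mult_ac)
  then have wm: "weight_moment \<mu> = sqrt pi / 2 * (Gamma (\<mu> / 2) * rGamma (\<mu> / 2 + 1 / 2))"
    unfolding half by simp
  have w: "weight_moment \<mu> / (pi * Gamma \<nu>) = rGamma \<nu> / (2 * sqrt pi) * gamma_ratio_real (\<mu> / 2)"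
  proof -
    define X where "X = Gamma (\<mu> / 2) * rGamma (\<mu> / 2 + 1 / 2)"
    have "sqrt pi / 2 * X / (pi * Gamma \<nu>) = (sqrt pi / pi) * (X / (2 * Gamma \<nu>))"
      by simp
    also have "sqrt pi / pi = inverse (sqrt pi)"
      by (rule sqrt_divide_self_eq) simp
    also have "inverse (sqrt pi) * (X / (2 * Gamma \<nu>)) = inverse (Gamma \<nu>) / (2 * sqrt pi) * X"
      by (simp only: divide_inverse inverse_mult_distrib mult_ac)
    finally show ?thesis
      by (simp only: wm gamma_ratio_real_def rGamma_inverse_Gamma[of \<nu>] X_def)
  qed
  have "product_coeff n (of_real \<nu>) = rGamma (of_real \<nu>) / (2 * of_real (sqrt pi)) * gamma_ratio (of_real (\<mu> / 2))"
    by (subst product_coeff_eq_gamma_ratio) (use \<nu> in \<open>auto simp: \<mu>_def\<close>)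
  also have "\<dots> = of_real (weight_moment \<mu> / (pi * Gamma \<nu>))"
    unfolding w gamma_ratio_of_real rGamma_complex_of_real by simp
  finally show ?thesis by (simp add: \<mu>_def)
qed

lemma laguerre_minus1_generating_function:
  fixes x s :: real
  assumes "\<bar>s\<bar> < 1"
  shows "(\<lambda>n. laguerre_minus1 n x * s ^ n) sums exp (- (x * s) / (1 - s))"
proof -
  have "(\<lambda>n. laguerre (- 1) n (of_real x) * of_real s ^ n) sums
    ((1 - of_real s) powr (- (- 1) - 1) * exp (- (of_real x * of_real s) / (1 - of_real s)))"
    by (rule laguerre_generating_function) (use assms in simp)
  moreover have "(1 - of_real s :: complex) \<noteq> 0"
    using assms by (metis abs_one eq_iff_diff_eq_0 less_irrefl of_real_eq_1_iff)
  moreover have "exp (- (of_real x * of_real s) / (1 - of_real s)) = (of_real (exp (- (x * s) / (1 - s))) :: complex)"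
    by (simp add: exp_of_real [symmetric])
  ultimately have "(\<lambda>n. of_real (laguerre_minus1 n x * s ^ n) :: complex) sums of_real (exp (- (x * s) / (1 - s)))"
    by (simp add: laguerre_eq_laguerre_minus1 laguerre_minus1_of_real)
  then show ?thesis
    by (simp only: sums_of_real_iff)
qed

lemma laguerre_minus1_partial_sums_bounded:
  assumes "x \<ge> 0"
  obtains C where "\<And>n. \<bar>\<Sum>i<n. laguerre_minus1 i x :: real\<bar> \<le> C" "\<And>n. \<bar>\<Sum>i<n. (- 1) ^ i * laguerre_minus1 i x :: real\<bar> \<le> C"
proof -
  obtain K1 where K1: "\<And>n. \<bar>\<Sum>k\<le>n. laguerre_minus1 k x\<bar> \<le> K1" "K1 > 0"
    using Bseq_sum_laguerre_minus1[OF assms] by (auto simp: Bseq_def)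
  obtain K2 where K2: "\<And>n. \<bar>\<Sum>k\<le>n. (- 1) ^ k * laguerre_minus1 k x\<bar> \<le> K2" "K2 > 0"
    using Bseq_alternating_sum_laguerre_minus1[OF assms] by (auto simp: Bseq_def)
  show ?thesis
  proof
    fix n
    show "\<bar>\<Sum>i<n. laguerre_minus1 i x\<bar> \<le> max K1 K2" "\<bar>\<Sum>i<n. (- 1) ^ i * laguerre_minus1 i x\<bar> \<le> max K1 K2"
      using K1 K2 by (cases n; simp add: lessThan_Suc_atMost le_max_iff_disj del: sum.lessThan_Suc)+
  qed
qed

lemma parabolic_product_sums_real:
  fixes z \<nu> :: real
  assumes z: "z > 0" and \<nu>: "\<nu> > 0"
  shows "(\<lambda>n. of_real (laguerre_minus1 n (z\<^sup>2)) * product_coeff n (of_real \<nu>)) sums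
       (parabolic_cylinder_D (- of_real \<nu>) (of_real z) ^ 2 / (of_real pi * exp (- (of_real z ^ 2) / 2)))"
    and "(\<lambda>n. of_real ((- 1) ^ n * laguerre_minus1 n (z\<^sup>2)) * product_coeff n (of_real \<nu>)) sums
       (parabolic_cylinder_D (- of_real \<nu>) (of_real z) * parabolic_cylinder_D (- of_real \<nu>) (- of_real z) / (of_real pi * exp (- (of_real z ^ 2) / 2)))"
proof -
  define P Q where "P = cylinder_even \<nu> z" and "Q = cylinder_odd \<nu> z"
  have G: "Gamma \<nu> > 0" using \<nu> by (rule Gamma_real_pos)
  have P: "P \<ge> 0" and Q: "Q \<ge> 0" "Q \<le> P"
    using cylinder_even_nonneg[OF \<nu>] cylinder_odd_nonneg[OF \<nu>] cylinder_integral_eq(2)[OF \<nu>] z by (auto simp: P_def Q_def)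
  obtain C where C: "\<And>n. \<bar>\<Sum>i<n. laguerre_minus1 i (z\<^sup>2) :: real\<bar> \<le> C" "\<And>n. \<bar>\<Sum>i<n. (- 1) ^ i * laguerre_minus1 i (z\<^sup>2) :: real\<bar> \<le> C"
    using laguerre_minus1_partial_sums_bounded[of "z\<^sup>2"] by auto
  have 1: "(\<lambda>n. laguerre_minus1 n (z\<^sup>2) * weight_moment (\<nu> + real n)) sums ((P - Q) * (P - Q) / Gamma \<nu>)"
  proof (rule weight_moment_sums[OF \<nu> C(1), where F = "\<lambda>w. exp (- z\<^sup>2 / w)"])
    fix w :: real assume w: "w > 0"
    \<comment> \<open>With s = 1 / (1 + w) one has s / (1 - s) = 1 / w.\<close>
    have "1 - 1 / (1 + w) = w / (1 + w)"
      using w by (simp add: field_simps)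
    then have eq: "- (z\<^sup>2 * (1 / (1 + w))) / (1 - 1 / (1 + w)) = - z\<^sup>2 / w"
      using w by simp
    show "(\<lambda>n. laguerre_minus1 n (z\<^sup>2) * (1 / (1 + w)) ^ n) sums exp (- z\<^sup>2 / w)"
      using laguerre_minus1_generating_function[of "1 / (1 + w)" "z\<^sup>2", unfolded eq] w by simp
  next
    show "ennreal ((P - Q) * (P - Q)) = ennreal (Gamma \<nu>) * (\<integral>\<^sup>+w\<in>{0<..}. ennreal (cylinder_weight \<nu> w * exp (- z\<^sup>2 / w)) \<partial>lborel)"
      using cylinder_integral_square[OF \<nu>, of z] cylinder_integral_eq(1)[OF \<nu>, of z] z Q
      by (simp add: P_def Q_def ennreal_mult')
  qed auto
  have 2: "(\<lambda>n. ((- 1) ^ n * laguerre_minus1 n (z\<^sup>2)) * weight_moment (\<nu> + real n)) sums ((P - Q) * (P + Q) / Gamma \<nu>)"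
  proof (rule weight_moment_sums[OF \<nu> C(2), where F = "\<lambda>w. exp (z\<^sup>2 / (2 + w))"])
    fix w :: real assume w: "w > 0"
    \<comment> \<open>With s = -1 / (1 + w) one has -s / (1 - s) = 1 / (2 + w); the sign of s
      becomes the factor (-1)^n.\<close>
    have "1 - (- (1 / (1 + w))) = (2 + w) / (1 + w)"
      using w by (simp add: field_simps)
    then have eq: "- (z\<^sup>2 * (- (1 / (1 + w)))) / (1 - (- (1 / (1 + w)))) = z\<^sup>2 / (2 + w)"
      using w by simp
    have eq': "laguerre_minus1 n (z\<^sup>2) * (- (1 / (1 + w))) ^ n = (- 1) ^ n * laguerre_minus1 n (z\<^sup>2) * (1 / (1 + w)) ^ n" for n
      by (subst power_minus) simp
    have "\<bar>- (1 / (1 + w))\<bar> < 1"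
      using w by simp
    from laguerre_minus1_generating_function[OF this, of "z\<^sup>2"]
    show "(\<lambda>n. (- 1) ^ n * laguerre_minus1 n (z\<^sup>2) * (1 / (1 + w)) ^ n) sums exp (z\<^sup>2 / (2 + w))"
      unfolding eq eq' .
  next
    show "ennreal ((P - Q) * (P + Q)) = ennreal (Gamma \<nu>) * (\<integral>\<^sup>+w\<in>{0<..}. ennreal (cylinder_weight \<nu> w * exp (z\<^sup>2 / (2 + w))) \<partial>lborel)"
      using cylinder_integral_mult_neg[OF \<nu>, of z] cylinder_integral_eq(1)[OF \<nu>, of z] cylinder_integral_neg_eq[OF \<nu>, of z] z P Q
      by (simp add: P_def Q_def ennreal_mult')
  qed (use P Q in auto)
  have D1: "parabolic_cylinder_D (- of_real \<nu>) (of_real z) = of_real (exp (- z\<^sup>2 / 4) / Gamma \<nu> * (P - Q))"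
    using parabolic_cylinder_D_of_real[OF \<nu>, of z] by (simp add: P_def Q_def)
  have D2: "parabolic_cylinder_D (- of_real \<nu>) (- of_real z) = of_real (exp (- z\<^sup>2 / 4) / Gamma \<nu> * (P + Q))"
    using parabolic_cylinder_D_of_real[OF \<nu>, of "- z"] by (simp add: P_def Q_def cylinder_even_def cylinder_odd_def)
  \<comment> \<open>Split so that it cancels the factor exp (-z^2 / 4) of each of the two cylinder
    functions.\<close>
  have e: "of_real pi * exp (- (of_real z ^ 2) / 2) = (of_real (pi * (exp (- z\<^sup>2 / 4) * exp (- z\<^sup>2 / 4))) :: complex)"
    by (simp add: exp_of_real [symmetric] exp_add [symmetric])
  have t: "of_real a * product_coeff n (of_real \<nu>) = of_real (1 / (pi * Gamma \<nu>) * (a * weight_moment (\<nu> + real n)))" for a n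
    unfolding product_coeff_of_real[OF \<nu>] by simp
  have "(parabolic_cylinder_D (- of_real \<nu>) (of_real z) ^ 2 / (of_real pi * exp (- (of_real z ^ 2) / 2))) =
     of_real (1 / (pi * Gamma \<nu>) * ((P - Q) * (P - Q) / Gamma \<nu>))"
    unfolding D1 e unfolding of_real_power [symmetric] of_real_divide [symmetric] using G by (simp add: power2_eq_square)
  then show "(\<lambda>n. of_real (laguerre_minus1 n (z\<^sup>2)) * product_coeff n (of_real \<nu>)) sums
       (parabolic_cylinder_D (- of_real \<nu>) (of_real z) ^ 2 / (of_real pi * exp (- (of_real z ^ 2) / 2)))"
    unfolding t by (simp only: sums_of_real_iff) (rule sums_mult[OF 1])
  have "(parabolic_cylinder_D (- of_real \<nu>) (of_real z) * parabolic_cylinder_D (- of_real \<nu>) (- of_real z) / (of_real pi * exp (- (of_real z ^ 2) / 2))) =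
     of_real (1 / (pi * Gamma \<nu>) * ((P - Q) * (P + Q) / Gamma \<nu>))"
    unfolding D1 D2 e unfolding of_real_mult [symmetric] of_real_divide [symmetric] using G by simp
  then show "(\<lambda>n. of_real ((- 1) ^ n * laguerre_minus1 n (z\<^sup>2)) * product_coeff n (of_real \<nu>)) sums
       (parabolic_cylinder_D (- of_real \<nu>) (of_real z) * parabolic_cylinder_D (- of_real \<nu>) (- of_real z) / (of_real pi * exp (- (of_real z ^ 2) / 2)))"
    unfolding t by (simp only: sums_of_real_iff) (rule sums_mult[OF 2])
qed

section \<open>Analytic continuation\<close>

lemma islimpt_positive_reals: "(1::complex) islimpt of_real ` {0<..}"
proof -
  have "(1::real) islimpt {0<..}"
    by (rule interior_limit_point) (simp add: interior_open)
  then have "of_real 1 islimpt (of_real ` {0<..} :: complex set)"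
    by (subst islimpt_isCont_image) (auto simp: eventually_at_filter)
  then show ?thesis by simp
qed

text \<open>The identity theorem with zeros accumulating at 1. It is applied first in the parameter
  \<nu>, later in the argument z.\<close>

lemma holomorphic_eq_of_positive_reals:
  assumes f: "f holomorphic_on UNIV" and g: "g holomorphic_on UNIV"
    and eq: "\<And>x::real. x > 0 \<Longrightarrow> f (of_real x) = g (of_real x)"
  shows "f w = (g w :: complex)"
proof -
  have "(\<lambda>w. f w - g w) w = 0"
  proof (rule analytic_continuation[where f = "\<lambda>w. f w - g w" and S = UNIV and U = "of_real ` {0<..}" and \<xi> = 1])
    show "(\<lambda>w. f w - g w) holomorphic_on UNIV"
      by (intro holomorphic_intros f g)
  qed (use eq islimpt_positive_reals in auto)
  then show ?thesis by simp
qed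

lemma parabolic_product_sums_positive:
  fixes z :: real and \<nu> :: complex
  assumes z: "z > 0"
  shows "(\<lambda>n. of_real (laguerre_minus1 n (z\<^sup>2)) * product_coeff n \<nu>) sums
       (parabolic_cylinder_D (- \<nu>) (of_real z) ^ 2 / (of_real pi * exp (- (of_real z ^ 2) / 2)))"
    and "(\<lambda>n. of_real ((- 1) ^ n * laguerre_minus1 n (z\<^sup>2)) * product_coeff n \<nu>) sums
       (parabolic_cylinder_D (- \<nu>) (of_real z) * parabolic_cylinder_D (- \<nu>) (- of_real z) / (of_real pi * exp (- (of_real z ^ 2) / 2)))"
proof -
  obtain C where C: "\<And>n. \<bar>\<Sum>i<n. laguerre_minus1 i (z\<^sup>2) :: real\<bar> \<le> C" "\<And>n. \<bar>\<Sum>i<n. (- 1) ^ i * laguerre_minus1 i (z\<^sup>2) :: real\<bar> \<le> C"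
    using laguerre_minus1_partial_sums_bounded[of "z\<^sup>2"] by auto
  \<comment> \<open>The second series has (-1)^i L_i^{-1} as its terms, and its alternating sums are
    the plain sums of the first. Two real bounds thus cover all four.\<close>
  have C': "norm (\<Sum>i<n. of_real (laguerre_minus1 i (z\<^sup>2)) :: complex) \<le> C"
    "norm (\<Sum>i<n. (- 1) ^ i * of_real (laguerre_minus1 i (z\<^sup>2)) :: complex) \<le> C"
    "norm (\<Sum>i<n. of_real ((- 1) ^ i * laguerre_minus1 i (z\<^sup>2)) :: complex) \<le> C"
    "norm (\<Sum>i<n. (- 1) ^ i * of_real ((- 1) ^ i * laguerre_minus1 i (z\<^sup>2)) :: complex) \<le> C" for n
  proof -
    have 1: "norm (of_real (\<Sum>i<n. laguerre_minus1 i (z\<^sup>2)) :: complex) \<le> C"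
      using C(1)[of n] by (simp only: norm_of_real)
    have 2: "norm (of_real (\<Sum>i<n. (- 1) ^ i * laguerre_minus1 i (z\<^sup>2)) :: complex) \<le> C"
      using C(2)[of n] by (simp only: norm_of_real)
    show "norm (\<Sum>i<n. of_real (laguerre_minus1 i (z\<^sup>2)) :: complex) \<le> C"
      "norm (\<Sum>i<n. (- 1) ^ i * of_real (laguerre_minus1 i (z\<^sup>2)) :: complex) \<le> C"
      "norm (\<Sum>i<n. of_real ((- 1) ^ i * laguerre_minus1 i (z\<^sup>2)) :: complex) \<le> C"
      "norm (\<Sum>i<n. (- 1) ^ i * of_real ((- 1) ^ i * laguerre_minus1 i (z\<^sup>2)) :: complex) \<le> C"
      using 1 2 by (simp_all add: mult.assoc [symmetric] power_add [symmetric] power_mult_distrib [symmetric])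
  qed
  from product_coeff_sum_holomorphic[OF C'(1,2)] obtain T
    where T: "T holomorphic_on UNIV" "\<And>\<nu>. (\<lambda>n. of_real (laguerre_minus1 n (z\<^sup>2)) * product_coeff n \<nu>) sums T \<nu>"
    by blast
  from product_coeff_sum_holomorphic[OF C'(3,4)] obtain T'
    where T': "T' holomorphic_on UNIV" "\<And>\<nu>. (\<lambda>n. of_real ((- 1) ^ n * laguerre_minus1 n (z\<^sup>2)) * product_coeff n \<nu>) sums T' \<nu>"
    by blast
  have "T \<nu> = parabolic_cylinder_D (- \<nu>) (of_real z) ^ 2 / (of_real pi * exp (- (of_real z ^ 2) / 2))"
  proof (rule holomorphic_eq_of_positive_reals[OF T(1), where g = "\<lambda>\<nu>. parabolic_cylinder_D (- \<nu>) (of_real z) ^ 2 / (of_real pi * exp (- (of_real z ^ 2) / 2))"])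
    show "(\<lambda>\<nu>. parabolic_cylinder_D (- \<nu>) (of_real z) ^ 2 / (of_real pi * exp (- (of_real z ^ 2) / 2))) holomorphic_on UNIV"
      by (intro holomorphic_intros parabolic_cylinder_D_holomorphic_parameter) auto
    show "T (of_real x) = parabolic_cylinder_D (- of_real x) (of_real z) ^ 2 / (of_real pi * exp (- (of_real z ^ 2) / 2))" if "x > 0" for x
      using T(2) parabolic_product_sums_real(1)[OF z that] by (rule sums_unique2)
  qed
  with T(2)[of \<nu>] show "(\<lambda>n. of_real (laguerre_minus1 n (z\<^sup>2)) * product_coeff n \<nu>) sums
       (parabolic_cylinder_D (- \<nu>) (of_real z) ^ 2 / (of_real pi * exp (- (of_real z ^ 2) / 2)))"
    by simp
  have "T' \<nu> = parabolic_cylinder_D (- \<nu>) (of_real z) * parabolic_cylinder_D (- \<nu>) (- of_real z) / (of_real pi * exp (- (of_real z ^ 2) / 2))"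
  proof (rule holomorphic_eq_of_positive_reals[OF T'(1), where g = "\<lambda>\<nu>. parabolic_cylinder_D (- \<nu>) (of_real z) * parabolic_cylinder_D (- \<nu>) (- of_real z) / (of_real pi * exp (- (of_real z ^ 2) / 2))"])
    show "(\<lambda>\<nu>. parabolic_cylinder_D (- \<nu>) (of_real z) * parabolic_cylinder_D (- \<nu>) (- of_real z) / (of_real pi * exp (- (of_real z ^ 2) / 2))) holomorphic_on UNIV"
      by (intro holomorphic_intros parabolic_cylinder_D_holomorphic_parameter) auto
    show "T' (of_real x) = parabolic_cylinder_D (- of_real x) (of_real z) * parabolic_cylinder_D (- of_real x) (- of_real z) / (of_real pi * exp (- (of_real z ^ 2) / 2))" if "x > 0" for x
      using T'(2) parabolic_product_sums_real(2)[OF z that] by (rule sums_unique2)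
  qed
  with T'(2)[of \<nu>] show "(\<lambda>n. of_real ((- 1) ^ n * laguerre_minus1 n (z\<^sup>2)) * product_coeff n \<nu>) sums
       (parabolic_cylinder_D (- \<nu>) (of_real z) * parabolic_cylinder_D (- \<nu>) (- of_real z) / (of_real pi * exp (- (of_real z ^ 2) / 2)))"
    by simp
qed

section \<open>Negative integer parameters and complex arguments\<close>

lemma laguerre_minus1_holomorphic [holomorphic_intros]:
  assumes "f holomorphic_on A"
  shows "(\<lambda>z. laguerre_minus1 n (f z :: complex)) holomorphic_on A"
  unfolding laguerre_minus1_def by (cases n) (auto intro!: holomorphic_intros assms)

text \<open>The factor (-m)_n vanishes for n > m. The identities for z > 0 hold for every complex
  \<nu>, hence at \<nu> = -m, and from the positive axis they continue in z.\<close>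

lemma parabolic_product_sums_neg_int:
  fixes z :: complex and m :: nat
  defines "\<nu> \<equiv> - of_nat m"
  shows "(\<lambda>n. laguerre_minus1 n (z\<^sup>2) * product_coeff n \<nu>) sums
       (parabolic_cylinder_D (- \<nu>) z ^ 2 / (of_real pi * exp (- (z ^ 2) / 2)))"
    and "(\<lambda>n. (- 1) ^ n * laguerre_minus1 n (z\<^sup>2) * product_coeff n \<nu>) sums
       (parabolic_cylinder_D (- \<nu>) z * parabolic_cylinder_D (- \<nu>) (- z) / (of_real pi * exp (- (z ^ 2) / 2)))"
proof -
  have 0: "product_coeff n \<nu> = 0" if "n \<notin> {..m}" for n
    using that by (auto simp: product_coeff_def \<nu>_def pochhammer_of_nat_eq_0_lemma)
  have fin: "(\<lambda>n. c n * product_coeff n \<nu>) sums (\<Sum>n\<le>m. c n * product_coeff n \<nu>)" for c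
    by (rule sums_finite) (use 0 in auto)
  have "(\<Sum>n\<le>m. laguerre_minus1 n (z\<^sup>2) * product_coeff n \<nu>) = parabolic_cylinder_D (- \<nu>) z ^ 2 / (of_real pi * exp (- (z ^ 2) / 2))"
  proof (rule holomorphic_eq_of_positive_reals[where f = "\<lambda>z. \<Sum>n\<le>m. laguerre_minus1 n (z\<^sup>2) * product_coeff n \<nu>" and g = "\<lambda>z. parabolic_cylinder_D (- \<nu>) z ^ 2 / (of_real pi * exp (- (z ^ 2) / 2))"])
    fix x :: real assume x: "x > 0"
    show "(\<Sum>n\<le>m. laguerre_minus1 n ((of_real x)\<^sup>2) * product_coeff n \<nu>) = parabolic_cylinder_D (- \<nu>) (of_real x) ^ 2 / (of_real pi * exp (- (of_real x ^ 2) / 2))"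
      using parabolic_product_sums_positive(1)[OF x, of \<nu>]
      by (intro sums_unique2[OF fin]) (simp flip: laguerre_minus1_of_real)
  qed (auto intro!: holomorphic_intros)
  with fin show "(\<lambda>n. laguerre_minus1 n (z\<^sup>2) * product_coeff n \<nu>) sums
       (parabolic_cylinder_D (- \<nu>) z ^ 2 / (of_real pi * exp (- (z ^ 2) / 2)))"
    by metis
  have "(\<Sum>n\<le>m. (- 1) ^ n * laguerre_minus1 n (z\<^sup>2) * product_coeff n \<nu>) = parabolic_cylinder_D (- \<nu>) z * parabolic_cylinder_D (- \<nu>) (- z) / (of_real pi * exp (- (z ^ 2) / 2))"
  proof (rule holomorphic_eq_of_positive_reals[where f = "\<lambda>z. \<Sum>n\<le>m. (- 1) ^ n * laguerre_minus1 n (z\<^sup>2) * product_coeff n \<nu>" and g = "\<lambda>z. parabolic_cylinder_D (- \<nu>) z * parabolic_cylinder_D (- \<nu>) (- z) / (of_real pi * exp (- (z ^ 2) / 2))"])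
    fix x :: real assume x: "x > 0"
    show "(\<Sum>n\<le>m. (- 1) ^ n * laguerre_minus1 n ((of_real x)\<^sup>2) * product_coeff n \<nu>) =
       parabolic_cylinder_D (- \<nu>) (of_real x) * parabolic_cylinder_D (- \<nu>) (- of_real x) / (of_real pi * exp (- (of_real x ^ 2) / 2))"
      using parabolic_product_sums_positive(2)[OF x, of \<nu>]
      by (intro sums_unique2[OF fin]) (simp flip: laguerre_minus1_of_real)
  qed (auto intro!: holomorphic_intros)
  with fin show "(\<lambda>n. (- 1) ^ n * laguerre_minus1 n (z\<^sup>2) * product_coeff n \<nu>) sums
       (parabolic_cylinder_D (- \<nu>) z * parabolic_cylinder_D (- \<nu>) (- z) / (of_real pi * exp (- (z ^ 2) / 2)))"
    by metis
qed

text \<open>Summability is asserted beside each value because \<open>suminf\<close> denotes some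
  value even for a divergent series.\<close>

theorem mainTheorem8:
  fixes z \<nu> :: complex
  assumes "(\<exists>x::real. x > 0 \<and> z = of_real x) \<or> (\<exists>k::int. k < 0 \<and> \<nu> = of_int k)"
  shows "(summable (\<lambda>n. laguerre (-1) n (z ^ 2) *
            (2 powr (- \<nu> - of_nat n) * pochhammer \<nu> n * rGamma ((1 + of_nat n + \<nu>) / 2) ^ 2)) \<and>
      parabolic_cylinder_D (- \<nu>) z ^ 2 =
        of_real pi * exp (- (z ^ 2) / 2) *
          (\<Sum>n. laguerre (-1) n (z ^ 2) *
            (2 powr (- \<nu> - of_nat n) * pochhammer \<nu> n * rGamma ((1 + of_nat n + \<nu>) / 2) ^ 2))) \<and>
    (summable (\<lambda>n. (-1) ^ n * laguerre (-1) n (z ^ 2) *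
            (2 powr (- \<nu> - of_nat n) * pochhammer \<nu> n * rGamma ((1 + of_nat n + \<nu>) / 2) ^ 2)) \<and>
      parabolic_cylinder_D (- \<nu>) z * parabolic_cylinder_D (- \<nu>) (- z) =
        of_real pi * exp (- (z ^ 2) / 2) *
          (\<Sum>n. (-1) ^ n * laguerre (-1) n (z ^ 2) *
            (2 powr (- \<nu> - of_nat n) * pochhammer \<nu> n * rGamma ((1 + of_nat n + \<nu>) / 2) ^ 2)))"
proof -
  let ?c = "of_real pi * exp (- (z ^ 2) / 2)"
  have sums: "(\<lambda>n. laguerre_minus1 n (z\<^sup>2) * product_coeff n \<nu>) sums (parabolic_cylinder_D (- \<nu>) z ^ 2 / ?c)"
    "(\<lambda>n. (- 1) ^ n * laguerre_minus1 n (z\<^sup>2) * product_coeff n \<nu>) sums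
       (parabolic_cylinder_D (- \<nu>) z * parabolic_cylinder_D (- \<nu>) (- z) / ?c)"
    using assms
  proof (atomize (full), elim disjE exE conjE)
    fix x :: real assume x: "x > 0" "z = of_real x"
    show "(\<lambda>n. laguerre_minus1 n (z\<^sup>2) * product_coeff n \<nu>) sums (parabolic_cylinder_D (- \<nu>) z ^ 2 / ?c) \<and>
      (\<lambda>n. (- 1) ^ n * laguerre_minus1 n (z\<^sup>2) * product_coeff n \<nu>) sums
       (parabolic_cylinder_D (- \<nu>) z * parabolic_cylinder_D (- \<nu>) (- z) / ?c)"
      using parabolic_product_sums_positive[OF x(1), of \<nu>] by (simp add: x(2) flip: laguerre_minus1_of_real)
  next
    fix k :: int assume k: "k < 0" "\<nu> = of_int k"
    then have "\<nu> = - of_nat (nat (- k))" by simp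
    then show "(\<lambda>n. laguerre_minus1 n (z\<^sup>2) * product_coeff n \<nu>) sums (parabolic_cylinder_D (- \<nu>) z ^ 2 / ?c) \<and>
      (\<lambda>n. (- 1) ^ n * laguerre_minus1 n (z\<^sup>2) * product_coeff n \<nu>) sums
       (parabolic_cylinder_D (- \<nu>) z * parabolic_cylinder_D (- \<nu>) (- z) / ?c)"
      using parabolic_product_sums_neg_int[where m = "nat (- k)" and z = z] by (simp only:)
  qed
  have c: "?c \<noteq> 0" by simp
  show ?thesis
    unfolding laguerre_eq_laguerre_minus1 product_coeff_def [symmetric]
    using sums[THEN sums_summable] sums[THEN sums_unique, symmetric] c by simp
qed

end
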